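(* Let $f:\mathbb{R}^N\to\mathbb{R}$ be convex and differentiable, let $\psi(x)=\sum_{i=1}^n\psi^i(x^i)$ with each $\psi^i:\mathbb{R}^{N_i}\to\mathbb{R}\cup\{+\infty\}$ convex and closed, and let $F=f+\psi$. Let $\hat S$ be a proper sampling with probability vector $p=(p_1,\dots,p_n)$ and let $v\in\mathbb{R}^n_{++}$ be such that $(f,\hat S)\sim ESO(v)$. For any optimal solution $x_*$ of the problem of minimizing $F$ over $\mathbb{R}^N$, the output of the APPROXis algorithm satisfies, for all $k\ge1$, $$\mathbf{E}[F(x_k)-F(x_* )]\le\frac{4\left[\big(1-\min_ip_i\big)\big(F(x_0)-F(x_* )\big)+\min_i\frac{p_i^2}{2}\,\|x_0-x_*\|^2_{v\circ p^{-2}}\right]}{\big((k-1)\min_ip_i+2\big)^2}.$$ In particular, for $\epsilon>0$ and $k\ge 1$, if $$k\ge\frac{2\sqrt{\big(1-\min_ip_i\big)\big(F(x_0)-F(x_* )\big)+\min_i\frac{p_i^2}{2}\,\|x_0-x_*\|^2_{v\circ p^{-2}}}}{\sqrt\epsilon\,\min_ip_i}-\frac{2}{\min_ip_i}+1,$$ then $\mathbf{E}[F(x_k)-F(x_* )]\le\epsilon$.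
   Context: Block structure: $\mathbb{R}^N=\mathbb{R}^{N_1}\times\dots\times\mathbb{R}^{N_n}$, $[n]=\{1,\dots,n\}$; $x^i\in\mathbb{R}^{N_i}$ is the $i$th block of $x\in\mathbb{R}^N$, and $U_i$ is the $N\times N_i$ column submatrix of the identity with $x^i=U_i^\top x$. For $S\subseteq[n]$, $h_{[S]}=\sum_{i\in S}U_ih^i$. $\nabla_i f(x)=U_i^\top\nabla f(x)$. $\langle\cdot,\cdot\rangle$ is the standard inner product. For each $i$, $B_i$ is a fixed (symmetric) positive definite $N_i\times N_i$ matrix and $\|x^i\|_i^2=\langle B_ix^i,x^i\rangle$. For $w\in\mathbb{R}^n_{++}$ (vectors with positive entries): $\langle x,y\rangle_w=\sum_i w_i\langle x^i,y^i\rangle$ and $\|x\|_w^2=\sum_i w_i\|x^i\|_i^2$. For vectors in $\mathbb{R}^n$: $\circ$ is the elementwise product, and $p^{-1},p^{-2}$ are elementwise powers. For $u\in\mathbb{R}^n$, $x\in\mathbb{R}^N$: $u\cdot x=\sum_i u_iU_ix^i$. $\mathrm{dom}\,\psi=\{x:\psi(x)<+\infty\}$. Sampling: a sampling $\hat S$ is a random subset of $[n]$; $p_i=\mathrm{Prob}(i\in\hat S)$; it is proper if $p_i>0$ for all $i$. ESO: $(f,\hat S)\sim ESO(v)$ means that for all $x,h\in\mathbb{R}^N$, $\mathbf{E}[f(x+h_{[\hat S]})]\le f(x)+\langle\nabla f(x),h\rangle_p+\frac12\|h\|^2_{v\circ p}$. APPROXis algorithm: choose $x_0\in\mathrm{dom}\,\psi$,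 set $z_0=x_0$ and $\theta_0=\min_ip_i$. For $k\ge0$: $y_k=(1-\theta_k)x_k+\theta_kz_k$; draw a random set $S_k$ with the distribution of $\hat S$, independently of the past; set $z_{k+1}^i=\arg\min_{z\in\mathbb{R}^{N_i}}\{\langle\nabla_if(y_k),z\rangle+\frac{\theta_kv_i}{2p_i}\|z-z_k^i\|_i^2+\psi^i(z)\}$ for $i\in S_k$ and $z_{k+1}^i=z_k^i$ for $i\notin S_k$; set $x_{k+1}=y_k+\theta_kp^{-1}\cdot(z_{k+1}-z_k)$ and $\theta_{k+1}=\frac12\big(\sqrt{\theta_k^4+4\theta_k^2}-\theta_k^2\big)$. *)

theory Defs
  imports "HOL-Probability.Probability"
begin

(* Block structure.  The space R^N is real^'N, the set [n] of blocks is the finite type 'n, and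
   b :: 'N => 'n sends each coordinate to its block, so that N_i = card {j. b j = i}.
   R^{N_i} is identified with the coordinate subspace of R^N of the vectors that vanish outside
   block i.  Under this identification U_i is the inclusion of that subspace, and U_i^T is the
   coordinate projection blk b i. *)

definition block_space :: "('N::finite \<Rightarrow> 'n) \<Rightarrow> 'n \<Rightarrow> (real^'N) set" where
  "block_space b i = {z. \<forall>j. b j \<noteq> i \<longrightarrow> z $ j = 0}"

definition blk :: "('N::finite \<Rightarrow> 'n) \<Rightarrow> 'n \<Rightarrow> real^'N \<Rightarrow> real^'N" where
  "blk b i x = (\<chi> j. if b j = i then x $ j else 0)"

definition blk_restrict :: "('N::finite \<Rightarrow> 'n) \<Rightarrow> 'n set \<Rightarrow> real^'N \<Rightarrow> real^'N" where
  "blk_restrict b T h = (\<Sum>i\<in>T. blk b i h)"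

definition blk_scale :: "('N::finite \<Rightarrow> 'n::finite) \<Rightarrow> real^'n \<Rightarrow> real^'N \<Rightarrow> real^'N" where
  "blk_scale b u x = (\<Sum>i\<in>UNIV. (u $ i) *\<^sub>R blk b i x)"

(* An N_i x N_i matrix is the (block i, block i) part of a matrix A in R^{N x N}; the entries of A
   outside that part play no role, here and below. *)

definition pos_def_block :: "('N::finite \<Rightarrow> 'n) \<Rightarrow> 'n \<Rightarrow> real^'N^'N \<Rightarrow> bool" where
  "pos_def_block b i A \<longleftrightarrow>
     (\<forall>r c. b r = i \<longrightarrow> b c = i \<longrightarrow> A $ r $ c = A $ c $ r) \<and>
     (\<forall>z\<in>block_space b i. z \<noteq> 0 \<longrightarrow> 0 < (A *v z) \<bullet> z)"

definition bnorm_sq ::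
  "('N::finite \<Rightarrow> 'n) \<Rightarrow> ('n \<Rightarrow> real^'N^'N) \<Rightarrow> 'n \<Rightarrow> real^'N \<Rightarrow> real" where
  "bnorm_sq b B i x = (B i *v blk b i x) \<bullet> blk b i x"

definition winner ::
  "('N::finite \<Rightarrow> 'n::finite) \<Rightarrow> real^'n \<Rightarrow> real^'N \<Rightarrow> real^'N \<Rightarrow> real" where
  "winner b w x y = (\<Sum>i\<in>UNIV. w $ i * (blk b i x \<bullet> blk b i y))"

definition wnorm_sq ::
  "('N::finite \<Rightarrow> 'n::finite) \<Rightarrow> ('n \<Rightarrow> real^'N^'N) \<Rightarrow> real^'n \<Rightarrow> real^'N \<Rightarrow> real" where
  "wnorm_sq b B w x = (\<Sum>i\<in>UNIV. w $ i * bnorm_sq b B i x)"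

(* The true gradient wherever f is differentiable. *)
definition grad :: "('a::real_inner \<Rightarrow> real) \<Rightarrow> 'a \<Rightarrow> 'a" where
  "grad f x = (THE d. GDERIV f x :> d)"

(* Functions with values in R \<union> {+\<infinity>} on a subspace V.  Closed means closed epigraph. *)

definition convex_ext_on :: "'a::real_vector set \<Rightarrow> ('a \<Rightarrow> ereal) \<Rightarrow> bool" where
  "convex_ext_on V g \<longleftrightarrow>
     (\<forall>x\<in>V. \<forall>y\<in>V. \<forall>t. 0 < t \<longrightarrow> t < 1 \<longrightarrow>
        g ((1 - t) *\<^sub>R x + t *\<^sub>R y) \<le> ereal (1 - t) * g x + ereal t * g y)"

definition closed_ext_on :: "'a::topological_space set \<Rightarrow> ('a \<Rightarrow> ereal) \<Rightarrow> bool" where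
  "closed_ext_on V g \<longleftrightarrow> closed {(z, t :: real). z \<in> V \<and> g z \<le> ereal t}"

definition separable ::
  "('N::finite \<Rightarrow> 'n::finite) \<Rightarrow> ('n \<Rightarrow> real^'N \<Rightarrow> ereal) \<Rightarrow> real^'N \<Rightarrow> ereal" where
  "separable b \<psi> x = (\<Sum>i\<in>UNIV. \<psi> i (blk b i x))"

definition objective ::
  "('N::finite \<Rightarrow> 'n::finite) \<Rightarrow> (real^'N \<Rightarrow> real) \<Rightarrow> ('n \<Rightarrow> real^'N \<Rightarrow> ereal) \<Rightarrow> real^'N \<Rightarrow> ereal"
  where
  "objective b f \<psi> x = ereal (f x) + separable b \<psi> x"

(* A sampling is given by its distribution, a probability mass function on the subsets of [n]. *)

definition sampling_prob :: "('n::finite) set pmf \<Rightarrow> real^'n" where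
  "sampling_prob D = (\<chi> i. measure_pmf.prob D {T. i \<in> T})"

definition proper_sampling :: "('n::finite) set pmf \<Rightarrow> bool" where
  "proper_sampling D \<longleftrightarrow> (\<forall>i. 0 < sampling_prob D $ i)"

definition ESO ::
  "('N::finite \<Rightarrow> 'n::finite) \<Rightarrow> ('n \<Rightarrow> real^'N^'N) \<Rightarrow> (real^'N \<Rightarrow> real) \<Rightarrow> 'n set pmf \<Rightarrow> real^'n \<Rightarrow> bool"
  where
  "ESO b B f D v \<longleftrightarrow>
     (\<forall>x h. measure_pmf.expectation D (\<lambda>T. f (x + blk_restrict b T h))
            \<le> f x + winner b (sampling_prob D) (grad f x) h
              + 1 / 2 * wnorm_sq b B (\<chi> i. v $ i * sampling_prob D $ i) h)"

definition vmin :: "real^('n::finite) \<Rightarrow> real" where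
  "vmin p = Min (range (\<lambda>i. p $ i))"

primrec approxis_theta :: "real^('n::finite) \<Rightarrow> nat \<Rightarrow> real" where
  "approxis_theta p 0 = vmin p"
| "approxis_theta p (Suc k) =
     (sqrt (approxis_theta p k ^ 4 + 4 * approxis_theta p k ^ 2) - approxis_theta p k ^ 2) / 2"

definition approxis_prox ::
  "('N::finite \<Rightarrow> 'n::finite) \<Rightarrow> ('n \<Rightarrow> real^'N^'N) \<Rightarrow> (real^'N \<Rightarrow> real) \<Rightarrow> ('n \<Rightarrow> real^'N \<Rightarrow> ereal)
   \<Rightarrow> real^'n \<Rightarrow> real^'n \<Rightarrow> real \<Rightarrow> real^'N \<Rightarrow> real^'N \<Rightarrow> 'n \<Rightarrow> real^'N" where
  "approxis_prox b B f \<psi> v p \<theta> y z i =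
     arg_min
       (\<lambda>u. ereal (blk b i (grad f y) \<bullet> u
                   + \<theta> * v $ i / (2 * p $ i) * bnorm_sq b B i (u - blk b i z)) + \<psi> i u)
       (\<lambda>u. u \<in> block_space b i)"

(* The pair (x_k, z_k) produced when the sets drawn are T 0, T 1, ...;
   it depends only on T 0, ..., T (k - 1). *)
primrec approxis ::
  "('N::finite \<Rightarrow> 'n::finite) \<Rightarrow> ('n \<Rightarrow> real^'N^'N) \<Rightarrow> (real^'N \<Rightarrow> real) \<Rightarrow> ('n \<Rightarrow> real^'N \<Rightarrow> ereal)
   \<Rightarrow> real^'n \<Rightarrow> real^'n \<Rightarrow> real^'N \<Rightarrow> (nat \<Rightarrow> 'n set) \<Rightarrow> nat \<Rightarrow> (real^'N) \<times> (real^'N)" where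
  "approxis b B f \<psi> v p x0 T 0 = (x0, x0)"
| "approxis b B f \<psi> v p x0 T (Suc k) =
     (let (x, z) = approxis b B f \<psi> v p x0 T k;
          \<theta> = approxis_theta p k;
          y = (1 - \<theta>) *\<^sub>R x + \<theta> *\<^sub>R z;
          z' = (\<Sum>i\<in>UNIV. if i \<in> T k then approxis_prox b B f \<psi> v p \<theta> y z i else blk b i z);
          x' = y + \<theta> *\<^sub>R blk_scale b (\<chi> i. inverse (p $ i)) (z' - z)
      in (x', z'))"

definition approxis_x ::
  "('N::finite \<Rightarrow> 'n::finite) \<Rightarrow> ('n \<Rightarrow> real^'N^'N) \<Rightarrow> (real^'N \<Rightarrow> real) \<Rightarrow> ('n \<Rightarrow> real^'N \<Rightarrow> ereal)
   \<Rightarrow> real^'n \<Rightarrow> real^'n \<Rightarrow> real^'N \<Rightarrow> (nat \<Rightarrow> 'n set) \<Rightarrow> nat \<Rightarrow> real^'N" where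
  "approxis_x b B f \<psi> v p x0 T k = fst (approxis b B f \<psi> v p x0 T k)"

(* The bracket in the convergence bound.  The difference of objective values is finite when x0 lies
   in the domain of the objective and xs minimises it. *)
definition approxis_const ::
  "('N::finite \<Rightarrow> 'n::finite) \<Rightarrow> ('n \<Rightarrow> real^'N^'N) \<Rightarrow> (real^'N \<Rightarrow> real) \<Rightarrow> ('n \<Rightarrow> real^'N \<Rightarrow> ereal)
   \<Rightarrow> real^'n \<Rightarrow> real^'n \<Rightarrow> real^'N \<Rightarrow> real^'N \<Rightarrow> real" where
  "approxis_const b B f \<psi> v p x0 xs =
     (1 - vmin p) * real_of_ereal (objective b f \<psi> x0 - objective b f \<psi> xs)
     + Min (range (\<lambda>i. (p $ i)\<^sup>2 / 2)) * wnorm_sq b B (\<chi> i. v $ i * inverse ((p $ i)\<^sup>2)) (x0 - xs)"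

(* E[F(X) - F(xs)] as an extended nonnegative expectation, which keeps the value infinity.
   e2ennreal sends negative numbers to 0, so xs has to be a minimiser. *)
definition expected_gap ::
  "'w measure \<Rightarrow> ('a \<Rightarrow> ereal) \<Rightarrow> 'a \<Rightarrow> ('w \<Rightarrow> 'a) \<Rightarrow> ennreal" where
  "expected_gap M F xs X = (\<integral>\<^sup>+\<omega>. e2ennreal (F (X \<omega>) - F xs) \<partial>M)"

end

theory Submission
  imports Defs
begin

text \<open>
  The proof follows one randomised estimate sequence.  The algorithm updates only the blocks in the
  drawn set, but the factors \<open>1 / p\<^sub>i\<close> make up for this in the mean: up to the factor \<open>\<theta>\<close>, the mean
  effect of a step is that of replacing every block of \<open>z\<close> by its proximal point.  The expected separable
  overapproximation bounds the mean of \<open>f\<close> at the new point by the quadratic model in which the proximal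
  points are computed, and strong convexity of the subproblems compares their minima with the values at
  the blocks of \<open>xs\<close>.

  The separable part of the objective at \<open>x\<close> cannot be followed directly, because the blocks of \<open>x\<close>
  are averages of the blocks of all former \<open>z\<close>.  In its place stands the surrogate \<open>psi_hat\<close>, the same
  average taken of the values \<open>\<psi> i\<close>, whose expected change is exactly computable.  That the weights
  of this average are nonnegative is what makes \<open>psi_hat\<close> an upper bound for \<open>\<psi>\<close>; it holds
  because the step sizes decrease and start at \<open>\<theta>\<^sub>0 \<le> p\<^sub>i\<close> (\<open>convex_accelerated_average\<close>).

  Write \<open>G\<^sub>k\<close> for the gap \<open>f (x\<^sub>k) + psi_hat - F (xs)\<close> and \<open>R\<^sub>k\<close> for the squared distance of \<open>z\<^sub>k\<close> to
  \<open>xs\<close> in the norm with weights \<open>v\<^sub>i / p\<^sub>i\<^sup>2\<close>.  One step (\<open>single_step\<close>) gives, conditionally on the past,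
  that the mean of \<open>G\<^sub>k\<^sub>+\<^sub>1 + \<theta>\<^sub>k\<^sup>2 / 2 * R\<^sub>k\<^sub>+\<^sub>1\<close> is at most \<open>(1 - \<theta>\<^sub>k) * G\<^sub>k + \<theta>\<^sub>k\<^sup>2 / 2 * R\<^sub>k\<close>.  Since
  \<open>\<theta>\<^sub>k\<^sub>+\<^sub>1\<^sup>2 = \<theta>\<^sub>k\<^sup>2 * (1 - \<theta>\<^sub>k\<^sub>+\<^sub>1)\<close>, the right-hand side at index \<open>k + 1\<close> is the left-hand side scaled
  by \<open>(\<theta>\<^sub>k\<^sub>+\<^sub>1 / \<theta>\<^sub>k)\<^sup>2\<close>, so the estimates telescope to a bound by \<open>(\<theta>\<^sub>k / \<theta>\<^sub>0)\<^sup>2\<close> times the initial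
  potential, which is the bracket of the theorem.  The rate follows because \<open>1 / \<theta>\<^sub>k\<close> grows by at least
  \<open>1/2\<close> per step.

  Two supporting facts need an argument of their own.  The proximal subproblems have minimisers
  because optimality of \<open>xs\<close> provides each \<open>\<psi> i\<close> with an affine minorant (\<open>\<psi>_affine_minorant\<close>), which
  makes the regularised functions coercive.  The expectations reduce to iterated finite ones because
  the iterate of index \<open>k\<close> depends only on the first \<open>k\<close> draws, whose joint law is a product
  (\<open>nn_integral_iid_prefix\<close>).
\<close>

section \<open>Finite prefixes of independent draws\<close>

text \<open>
  Independence gives the probability of each of the finitely many prefixes of length \<open>k\<close> as a product, and
  summing over the prefixes gives the integral.  On the right the last draw can be split off as a factor.
  The constant \<open>d\<close> fills the coordinates from \<open>k\<close> on.
\<close>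

lemma (in prob_space) nn_integral_iid_prefix:
  fixes S :: "nat \<Rightarrow> 'a \<Rightarrow> 'b::finite" and H :: "(nat \<Rightarrow> 'b) \<Rightarrow> ennreal"
  assumes indep: "indep_vars (\<lambda>_. count_space UNIV) S UNIV"
    and distr: "\<And>k. distr M (count_space UNIV) (S k) = measure_pmf D"
  shows "(\<integral>\<^sup>+\<omega>. H (\<lambda>j. if j < k then S j \<omega> else d) \<partial>M)
       = (\<integral>\<^sup>+\<tau>. H \<tau> \<partial>measure_pmf (Pi_pmf {..<k} d (\<lambda>_. D)))"
proof -
  define P where "P = PiE_dflt {..<k} d (\<lambda>_. UNIV :: 'b set)"
  define E where "E \<tau> = {\<omega>\<in>space M. \<forall>j<k. S j \<omega> = \<tau> j}" for \<tau> :: "nat \<Rightarrow> 'b"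
  have finP: "finite P"
    unfolding P_def by (rule finite_PiE_dflt) auto
  have meas: "S j \<in> measurable M (count_space UNIV)" for j
    using indep by (auto simp: indep_vars_def2)
  have prob_single: "prob (S j -` {a} \<inter> space M) = pmf D a" for j a
    using measure_distr[OF meas, of "{a}" j] by (simp add: distr measure_pmf_single)
  have E_eq: "E \<tau> = (\<Inter>j\<in>{..<k}. S j -` {\<tau> j} \<inter> space M)" if "k > 0" for \<tau>
    using that by (auto simp: E_def)
  have E_sets: "E \<tau> \<in> events" for \<tau>
  proof (cases "k = 0")
    case True
    then show ?thesis by (simp add: E_def)
  next
    case False
    then show ?thesis
      using meas by (subst E_eq) (auto intro!: sets.finite_INT measurable_sets)
  qed
  have E_prob: "prob (E \<tau>) = (\<Prod>j<k. pmf D (\<tau> j))" for \<tau>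
  proof (cases "k = 0")
    case True
    then show ?thesis by (simp add: E_def prob_space)
  next
    case False
    then show ?thesis
      using indep_varsD[OF indep, of "{..<k}" "\<lambda>j. {\<tau> j}"] by (simp add: E_eq prob_single lessThan_empty_iff)
  qed
  have pmf_P: "pmf (Pi_pmf {..<k} d (\<lambda>_. D)) \<tau> = prob (E \<tau>)" if "\<tau> \<in> P" for \<tau>
    using that by (subst pmf_Pi) (auto simp: P_def PiE_dflt_def E_prob)
  have "(\<integral>\<^sup>+\<omega>. H (\<lambda>j. if j < k then S j \<omega> else d) \<partial>M)
      = (\<integral>\<^sup>+\<omega>. (\<Sum>\<tau>\<in>P. H \<tau> * indicator (E \<tau>) \<omega>) \<partial>M)"
  proof (rule nn_integral_cong)
    fix \<omega> assume "\<omega> \<in> space M"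
    define \<sigma> where "\<sigma> = (\<lambda>j. if j < k then S j \<omega> else d)"
    have \<sigma>P: "\<sigma> \<in> P" by (auto simp: P_def PiE_dflt_def \<sigma>_def)
    have "indicator (E \<tau>) \<omega> = (if \<tau> = \<sigma> then 1 else (0::ennreal))" if "\<tau> \<in> P" for \<tau>
      using that \<open>\<omega> \<in> space M\<close> by (auto simp: P_def PiE_dflt_def \<sigma>_def E_def fun_eq_iff indicator_def)
    then have "(\<Sum>\<tau>\<in>P. H \<tau> * indicator (E \<tau>) \<omega>) = (\<Sum>\<tau>\<in>P. if \<tau> = \<sigma> then H \<tau> else 0)"
      by (intro sum.cong) auto
    also have "\<dots> = H \<sigma>" using finP \<sigma>P by simp
    finally show "H (\<lambda>j. if j < k then S j \<omega> else d) = (\<Sum>\<tau>\<in>P. H \<tau> * indicator (E \<tau>) \<omega>)"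
      by (simp add: \<sigma>_def)
  qed
  also have "\<dots> = (\<Sum>\<tau>\<in>P. H \<tau> * ennreal (prob (E \<tau>)))"
    using E_sets by (simp add: nn_integral_sum nn_integral_cmult_indicator emeasure_eq_measure)
  also have "\<dots> = (\<integral>\<^sup>+\<tau>. H \<tau> \<partial>measure_pmf (Pi_pmf {..<k} d (\<lambda>_. D)))"
  proof (subst nn_integral_measure_pmf_support[OF finP])
    show "H \<tau> = 0" if "\<tau> \<in> set_pmf (Pi_pmf {..<k} d (\<lambda>_. D))" "\<tau> \<notin> P" for \<tau>
      using that set_Pi_pmf_subset'[of "{..<k}" d "\<lambda>_. D"] by (auto simp: P_def PiE_dflt_def)
  qed (auto simp: pmf_P)
  finally show ?thesis .
qed

section \<open>The step size sequence\<close>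

text \<open>
  The new step size \<open>s\<close> is the positive root of \<open>s\<^sup>2 + t\<^sup>2 * s = t\<^sup>2\<close>.  The growth of the inverses comes
  from \<open>1/s - 1/t = t / (t + s)\<close> together with \<open>s \<le> t\<close>.
\<close>

lemma approxis_theta_bounds:
  assumes "0 < vmin p" "vmin p \<le> 1"
  shows approxis_theta_pos: "0 < approxis_theta p k"
    and approxis_theta_le: "approxis_theta p k \<le> vmin p"
    and approxis_theta_rec: "(approxis_theta p (Suc k))\<^sup>2 = (approxis_theta p k)\<^sup>2 * (1 - approxis_theta p (Suc k))"
    and approxis_theta_decreasing: "approxis_theta p (Suc k) \<le> approxis_theta p k"
    and inverse_approxis_theta_growth: "inverse (approxis_theta p k) + 1 / 2 \<le> inverse (approxis_theta p (Suc k))"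
proof -
  have step: "0 < s \<and> s\<^sup>2 = t\<^sup>2 * (1 - s) \<and> s \<le> t \<and> inverse t + 1 / 2 \<le> inverse s"
    if t: "0 < t" and s: "s = (sqrt (t ^ 4 + 4 * t ^ 2) - t ^ 2) / 2" for s t :: real
  proof -
    \<comment> \<open>The formula for the new step size solved for its square root.\<close>
    have sq: "(2 * s + t\<^sup>2)\<^sup>2 = t ^ 4 + 4 * t\<^sup>2"
    proof -
      have "2 * s + t\<^sup>2 = sqrt (t ^ 4 + 4 * t\<^sup>2)" by (simp add: s field_simps)
      then show ?thesis by simp
    qed
    then have eq: "s\<^sup>2 = t\<^sup>2 * (1 - s)"
      by (simp add: power2_eq_square power4_eq_xxxx algebra_simps)
    have "t\<^sup>2 < sqrt (t ^ 4 + 4 * t\<^sup>2)"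
      using t by (intro real_less_rsqrt) simp
    then have pos: "0 < s" by (simp add: s)
    have "s\<^sup>2 \<le> t\<^sup>2" using pos by (simp add: eq mult_left_le)
    then have le: "s \<le> t" using t by (simp add: power2_le_iff_abs_le)
    have "(t - s) * (t + s) = t * s * t"
      using eq by (simp add: power2_eq_square algebra_simps)
    moreover have "t * s * (t + s) \<le> 2 * (t * s * t)"
      using le t pos by (simp add: mult_left_mono)
    moreover have "(2 * (t - s)) * (t + s) = 2 * ((t - s) * (t + s))"
      by (rule mult.assoc)
    ultimately have "t * s * (t + s) \<le> (2 * (t - s)) * (t + s)"
      by linarith
    then have "t * s \<le> 2 * (t - s)" using t pos by simp
    then have "inverse t + 1 / 2 \<le> inverse s"
      using t pos by (simp add: field_simps)
    with pos eq le show ?thesis by simp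
  qed
  have pos: "0 < approxis_theta p k" for k
  proof (induction k)
    case (Suc k)
    show ?case by (rule conjunct1[OF step[OF Suc]]) simp
  qed (simp add: assms(1))
  have suc: "0 < approxis_theta p (Suc k) \<and> (approxis_theta p (Suc k))\<^sup>2 = (approxis_theta p k)\<^sup>2 * (1 - approxis_theta p (Suc k))
     \<and> approxis_theta p (Suc k) \<le> approxis_theta p k \<and> inverse (approxis_theta p k) + 1 / 2 \<le> inverse (approxis_theta p (Suc k))" for k
    by (rule step[OF pos]) simp
  show "0 < approxis_theta p k" by (rule pos)
  show "approxis_theta p k \<le> vmin p"
  proof (induction k)
    case (Suc k)
    then show ?case using suc[of k] by linarith
  qed simp
  show "(approxis_theta p (Suc k))\<^sup>2 = (approxis_theta p k)\<^sup>2 * (1 - approxis_theta p (Suc k))"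
    "approxis_theta p (Suc k) \<le> approxis_theta p k"
    "inverse (approxis_theta p k) + 1 / 2 \<le> inverse (approxis_theta p (Suc k))"
    using suc by blast+
qed

lemma approxis_theta_decay:
  assumes "0 < vmin p" "vmin p \<le> 1"
  shows "approxis_theta p k / vmin p \<le> 2 / (real k * vmin p + 2)"
proof -
  have "inverse (vmin p) + real k / 2 \<le> inverse (approxis_theta p k)"
  proof (induction k)
    case (Suc k)
    have "real (Suc k) / 2 = real k / 2 + 1 / 2" by simp
    with Suc inverse_approxis_theta_growth[OF assms, of k] show ?case by linarith
  qed simp
  moreover have "0 < real k * vmin p + 2" using assms(1) by (simp add: add_nonneg_pos)
  ultimately show ?thesis
    using assms approxis_theta_pos[OF assms, of k] by (simp add: field_simps)
qed

section \<open>Accelerated averages stay in convex sets\<close>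

text \<open>
  Unrolled, \<open>X k\<close> is an affine combination of \<open>Z 0, \<dots>, Z k\<close>, and the claim is that its coefficients are
  nonnegative.  The negative term \<open>- \<theta> k / p\<close> only meets the coefficient of \<open>Z k\<close>, so it suffices to
  carry the weight \<open>a k\<close> of \<open>Z k\<close> in \<open>X k\<close> and to lump all older points into one point \<open>e\<close> of \<open>C\<close>.
\<close>

lemma convex_accelerated_average:
  fixes X Z :: "nat \<Rightarrow> 'a::real_vector" and \<theta> :: "nat \<Rightarrow> real"
  assumes C: "convex C" and Z: "\<And>k. Z k \<in> C"
    and X0: "X 0 = Z 0"
    and X: "\<And>k. X (Suc k) = (1 - \<theta> k) *\<^sub>R X k + \<theta> k *\<^sub>R Z k + (\<theta> k / p) *\<^sub>R (Z (Suc k) - Z k)"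
    and \<theta>_pos: "\<And>k. 0 < \<theta> k" and \<theta>_le: "\<And>k. \<theta> k \<le> p" and p: "p \<le> 1"
    and \<theta>_decreasing: "\<And>k. \<theta> (Suc k) \<le> \<theta> k"
  shows "X k \<in> C"
proof -
  define a where "a k = (case k of 0 \<Rightarrow> 1 | Suc l \<Rightarrow> \<theta> l / p)" for k
  have ppos: "0 < p" using \<theta>_pos[of 0] \<theta>_le[of 0] by linarith
  have a01: "0 \<le> a k" "a k \<le> 1" for k
    using \<theta>_pos \<theta>_le ppos by (auto simp: a_def less_imp_le split: nat.split)
  \<comment> \<open>The new coefficient of \<open>Z k\<close>.  For \<open>k = Suc l\<close> it is nonnegative because
      \<open>(1 - \<theta> k) * \<theta> l \<ge> (1 - p) * \<theta> k\<close>, both factors being at least as large on the left.\<close>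
  have coeff: "0 \<le> (1 - \<theta> k) * a k + \<theta> k - \<theta> k / p" for k
  proof (cases k)
    case 0
    then show ?thesis using a01[of "Suc 0"] by (simp add: a_def)
  next
    case (Suc l)
    define s t where "s = \<theta> k" and "t = \<theta> l"
    have st: "0 < s" "s \<le> p" "s \<le> t"
      using \<theta>_pos \<theta>_le \<theta>_decreasing[of l] by (auto simp: s_def t_def Suc)
    have "s * (1 - s) \<le> t * (1 - s)"
      using st p by (intro mult_right_mono) auto
    moreover have "s * (1 - p) \<le> s * (1 - s)" using st by (intro mult_left_mono) auto
    ultimately have "0 \<le> ((1 - s) * t + s * p - s) / p"
      using ppos by (simp add: algebra_simps)
    also have "((1 - s) * t + s * p - s) / p = (1 - s) * (t / p) + s - s / p"
      using ppos by (simp add: add_divide_distrib diff_divide_distrib)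
    finally show ?thesis by (simp add: a_def Suc s_def t_def)
  qed
  have "\<exists>e\<in>C. X k = (1 - a k) *\<^sub>R e + a k *\<^sub>R Z k" for k
  proof (induction k)
    case 0
    then show ?case using Z X0 by (auto simp: a_def)
  next
    case (Suc k)
    then obtain e where e: "e \<in> C" "X k = (1 - a k) *\<^sub>R e + a k *\<^sub>R Z k" by blast
    define \<alpha> \<beta> where "\<alpha> = (1 - \<theta> k) * (1 - a k)"
      and "\<beta> = (1 - \<theta> k) * a k + \<theta> k - \<theta> k / p"
    have aS: "a (Suc k) = \<theta> k / p" by (simp add: a_def)
    have \<alpha>: "0 \<le> \<alpha>"
      using a01[of k] \<theta>_le[of k] p by (simp add: \<alpha>_def)
    have \<beta>: "0 \<le> \<beta>" using coeff by (simp add: \<beta>_def)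
    have sum: "\<alpha> + \<beta> = 1 - a (Suc k)" by (simp add: \<alpha>_def \<beta>_def aS algebra_simps)
    have XS: "X (Suc k) = (\<alpha> *\<^sub>R e + \<beta> *\<^sub>R Z k) + a (Suc k) *\<^sub>R Z (Suc k)"
      by (simp add: X e(2) \<alpha>_def \<beta>_def aS algebra_simps)
    show ?case
    proof (cases "\<alpha> + \<beta> = 0")
      case True
      then have "\<alpha> = 0" "\<beta> = 0" using \<alpha> \<beta> by auto
      then show ?thesis using XS sum e(1) by auto
    next
      case False
      define e' where "e' = (\<alpha> / (\<alpha> + \<beta>)) *\<^sub>R e + (\<beta> / (\<alpha> + \<beta>)) *\<^sub>R Z k"
      have "e' \<in> C"
        unfolding e'_def using C e(1) Z \<alpha> \<beta> False
        by (intro convexD) (auto simp flip: add_divide_distrib)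
      moreover have "(1 - a (Suc k)) *\<^sub>R e' = \<alpha> *\<^sub>R e + \<beta> *\<^sub>R Z k"
        using False by (simp add: e'_def flip: sum add: scaleR_add_right)
      ultimately show ?thesis using XS by metis
    qed
  qed
  then obtain e where "e \<in> C" "X k = (1 - a k) *\<^sub>R e + a k *\<^sub>R Z k" by blast
  then show ?thesis
    using C Z a01[of k] by (auto intro: convexD)
qed

section \<open>Gradients and tangent planes\<close>

lemma gderiv_grad:
  fixes f :: "'a::euclidean_space \<Rightarrow> real"
  assumes "f differentiable (at x)"
  shows "GDERIV f x :> grad f x"
proof -
  from assms obtain L where L: "(f has_derivative L) (at x)"
    by (auto simp: differentiable_def)
  then have lin: "linear L" by (rule has_derivative_linear)
  define d where "d = (\<Sum>i\<in>Basis. L i *\<^sub>R i)"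
  have Leq: "L = (\<lambda>h. h \<bullet> d)"
  proof
    fix h
    have "L h = L (\<Sum>i\<in>Basis. (h \<bullet> i) *\<^sub>R i)" by (simp add: euclidean_representation)
    also have "\<dots> = (\<Sum>i\<in>Basis. (h \<bullet> i) * L i)"
      using lin by (simp add: linear_sum linear_cmul)
    also have "\<dots> = h \<bullet> d" by (simp add: d_def inner_sum_right mult.commute)
    finally show "L h = h \<bullet> d" .
  qed
  have G: "GDERIV f x :> d" using L by (simp add: gderiv_def Leq)
  have "d' = d" if "GDERIV f x :> d'" for d'
  proof -
    have "(\<lambda>h. h \<bullet> d') = (\<lambda>h. h \<bullet> d)"
      using that G unfolding gderiv_def by (rule has_derivative_unique)
    then have "(d' - d) \<bullet> d' = (d' - d) \<bullet> d" by (rule fun_cong)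
    then have "(d' - d) \<bullet> (d' - d) = 0" by (simp add: inner_diff_right)
    then show ?thesis by simp
  qed
  with G show ?thesis unfolding grad_def by (rule theI)
qed

text \<open>
  A limit of difference quotients from the right turns inequalities along a segment into inequalities for
  the gradient: here the tangent plane of a convex function, and below the affine minorant of the
  nonsmooth part at a minimiser.
\<close>

lemma grad_directional_limit:
  fixes f :: "'a::euclidean_space \<Rightarrow> real"
  assumes "f differentiable (at x)"
  shows "((\<lambda>t. (f (x + t *\<^sub>R d) - f x) / t) \<longlongrightarrow> grad f x \<bullet> d) (at_right 0)"
proof -
  have "((\<lambda>t. f (x + t *\<^sub>R d)) has_derivative (\<lambda>t. (t *\<^sub>R d) \<bullet> grad f x)) (at 0)"
  proof (rule has_derivative_compose[where f = "\<lambda>t. x + t *\<^sub>R d" and f' = "\<lambda>t. t *\<^sub>R d"])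
    show "((\<lambda>t. x + t *\<^sub>R d) has_derivative (\<lambda>t. t *\<^sub>R d)) (at 0)"
      by (auto intro!: derivative_eq_intros)
    show "(f has_derivative (\<lambda>h. h \<bullet> grad f x)) (at (x + 0 *\<^sub>R d))"
      using gderiv_grad[OF assms] by (simp add: gderiv_def)
  qed
  then have "((\<lambda>t. f (x + t *\<^sub>R d)) has_field_derivative grad f x \<bullet> d) (at 0)"
    unfolding has_field_derivative_def
    by (rule has_derivative_eq_rhs) (auto simp: fun_eq_iff inner_commute)
  then have "((\<lambda>t. (f (x + t *\<^sub>R d) - f x) / t) \<longlongrightarrow> grad f x \<bullet> d) (at 0)"
    by (simp add: has_field_derivative_iff)
  then show ?thesis by (rule filterlim_mono) (auto simp: at_le)
qed

lemma convex_on_above_tangent_plane: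
  fixes f :: "'a::euclidean_space \<Rightarrow> real"
  assumes "convex_on UNIV f" "f differentiable (at x)"
  shows "f x + grad f x \<bullet> (w - x) \<le> f w"
proof -
  have "grad f x \<bullet> (w - x) \<le> f w - f x"
  proof (rule tendsto_upperbound[OF grad_directional_limit[OF assms(2)]])
    show "\<forall>\<^sub>F t in at_right 0. (f (x + t *\<^sub>R (w - x)) - f x) / t \<le> f w - f x"
    proof (rule eventually_at_rightI[of 0 1])
      fix t :: real assume t: "t \<in> {0<..<1}"
      have "f ((1 - t) *\<^sub>R x + t *\<^sub>R w) \<le> (1 - t) * f x + t * f w"
        using t by (intro convex_onD[OF assms(1)]) auto
      then have "f (x + t *\<^sub>R (w - x)) - f x \<le> t * (f w - f x)"
        by (simp add: algebra_simps)
      then show "(f (x + t *\<^sub>R (w - x)) - f x) / t \<le> f w - f x"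
        using t by (simp add: divide_le_eq mult.commute)
    qed simp
  qed simp
  then show ?thesis by simp
qed

section \<open>Existence of minimisers\<close>

text \<open>
  The function \<open>g\<close> is only lower semicontinuous, so the minimum is taken over the sublevel part \<open>K\<close> of its
  epigraph instead: there the objective becomes the continuous function \<open>l u + t\<close>.  Closedness of the
  epigraph makes \<open>K\<close> closed, and quadratic growth of \<open>l\<close> against the affine minorant of \<open>g\<close> makes it
  bounded.
\<close>

lemma exists_minimizer_coercive:
  fixes g :: "'a::euclidean_space \<Rightarrow> ereal" and l :: "'a \<Rightarrow> real"
  assumes closed: "closed_ext_on V g"
    and cont: "continuous_on UNIV l"
    and w: "w \<in> V" "g w < \<infinity>"
    and minorant: "\<And>u. u \<in> V \<Longrightarrow> ereal (\<alpha> + d \<bullet> u) \<le> g u"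
    and quad: "\<And>u. u \<in> V \<Longrightarrow> \<mu> * (norm (u - z))\<^sup>2 + c \<bullet> u \<le> l u" and \<mu>: "0 < \<mu>"
  shows "\<exists>u\<in>V. \<forall>u'\<in>V. ereal (l u) + g u \<le> ereal (l u') + g u'"
proof -
  define s where "s = real_of_ereal (g w)"
  have gw: "g w = ereal s"
    using w minorant[OF w(1)] by (cases "g w") (auto simp: s_def)
  define K where "K = {(u, t). u \<in> V \<and> g u \<le> ereal t \<and> l u + t \<le> l w + s}"
  have "K = {(u, t). u \<in> V \<and> g u \<le> ereal t} \<inter> {e. l (fst e) + snd e \<le> l w + s}"
    by (auto simp: K_def)
  moreover have contK: "continuous_on UNIV (\<lambda>e::'a \<times> real. l (fst e) + snd e)"
    by (intro continuous_intros continuous_on_compose2[OF cont]) auto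
  ultimately have closedK: "closed K"
    using closed by (auto simp: closed_ext_on_def intro!: closed_Collect_le continuous_intros)
  \<comment> \<open>On \<open>K\<close>, \<open>\<mu> * r\<^sup>2 \<le> C + G * r\<close> for \<open>r = norm (u - z)\<close>; this bounds \<open>r\<close> by \<open>max 1 ((\<bar>C\<bar> + G) / \<mu>)\<close>.\<close>
  define G where "G = norm (c + d)"
  define C where "C = l w + s - \<alpha> - (c + d) \<bullet> z"
  define r where "r = max 1 ((\<bar>C\<bar> + G) / \<mu>)"
  have bound: "norm (u - z) \<le> r" if "(u, t) \<in> K" for u t
  proof (rule ccontr)
    assume "\<not> norm (u - z) \<le> r"
    then have big: "1 < norm (u - z)" "(\<bar>C\<bar> + G) / \<mu> < norm (u - z)" by (auto simp: r_def)
    have u: "u \<in> V" "g u \<le> ereal t" "l u + t \<le> l w + s" using that by (auto simp: K_def)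
    have "ereal (\<alpha> + d \<bullet> u) \<le> ereal t" using minorant[OF u(1)] u(2) by (rule order_trans)
    then have "\<mu> * (norm (u - z))\<^sup>2 \<le> C - (c + d) \<bullet> (u - z)"
      using quad[OF u(1)] u(3) by (simp add: C_def inner_simps)
    also have "\<dots> \<le> \<bar>C\<bar> + G * norm (u - z)"
      using Cauchy_Schwarz_ineq2[of "c + d" "u - z"] by (simp add: G_def)
    also have "\<dots> \<le> (\<bar>C\<bar> + G) * norm (u - z)"
      using big(1) mult_left_mono[of 1 "norm (u - z)" "\<bar>C\<bar>"] by (simp add: algebra_simps)
    finally have "\<mu> * norm (u - z) * norm (u - z) \<le> (\<bar>C\<bar> + G) * norm (u - z)"
      by (simp add: power2_eq_square mult.assoc)
    then have "\<mu> * norm (u - z) \<le> \<bar>C\<bar> + G"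
      using big(1) by (meson mult_right_le_imp_le less_trans zero_less_one)
    then show False using big(2) \<mu> by (simp add: divide_less_eq mult.commute)
  qed
  have "bounded K"
  proof -
    have "compact (cball z r)" by simp
    then have "bounded (l ` cball z r)"
      by (intro compact_imp_bounded compact_continuous_image) (auto intro: continuous_on_subset[OF cont])
    then obtain L where "\<forall>y\<in>l ` cball z r. norm y \<le> L"
      unfolding bounded_iff by blast
    then have L: "\<And>u. u \<in> cball z r \<Longrightarrow> \<bar>l u\<bar> \<le> L" by simp
    define J where "J = \<bar>\<alpha>\<bar> + norm d * (norm z + r) + L + \<bar>l w + s\<bar>"
    have "K \<subseteq> cball z r \<times> {-J..J}"
    proof (rule subsetI, clarify)
      fix u t assume ut: "(u, t) \<in> K"
      then have ucb: "u \<in> cball z r" using bound by (simp add: dist_norm norm_minus_commute)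
      have u: "u \<in> V" "g u \<le> ereal t" "l u + t \<le> l w + s" using ut by (auto simp: K_def)
      have "ereal (\<alpha> + d \<bullet> u) \<le> ereal t" using minorant[OF u(1)] u(2) by (rule order_trans)
      then have lo: "\<alpha> + d \<bullet> u \<le> t" by simp
      have "norm u \<le> norm z + r"
        using norm_triangle_sub[of u z] bound[OF ut] by linarith
      then have "norm d * norm u \<le> norm d * (norm z + r)" by (intro mult_left_mono) auto
      then have du: "\<bar>d \<bullet> u\<bar> \<le> norm d * (norm z + r)"
        using Cauchy_Schwarz_ineq2[of d u] by linarith
      then have "0 \<le> norm d * (norm z + r)" by linarith
      with du lo L[OF ucb] u(3) show "u \<in> cball z r \<and> t \<in> {-J..J}"
        using ucb by (auto simp: J_def)
    qed
    then show ?thesis by (rule bounded_subset[rotated]) (intro bounded_Times bounded_cball bounded_closed_interval)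
  qed
  with closedK have "compact K" by (simp add: compact_eq_bounded_closed)
  moreover have "(w, s) \<in> K" using w(1) gw by (simp add: K_def)
  ultimately obtain e where e: "e \<in> K" "\<And>e'. e' \<in> K \<Longrightarrow> l (fst e) + snd e \<le> l (fst e') + snd e'"
    using continuous_attains_inf[of K "\<lambda>e. l (fst e) + snd e"] continuous_on_subset[OF contK] by blast
  obtain u t where ut: "e = (u, t)" by force
  have u: "u \<in> V" "g u \<le> ereal t" "l u + t \<le> l w + s" using e(1) by (auto simp: K_def ut)
  have "ereal (l u) + g u \<le> ereal (l u') + g u'" if u': "u' \<in> V" for u'
  proof -
    have "ereal (l u) + g u \<le> ereal (l u + t)" using u(2) by (cases "g u") auto
    also have "\<dots> \<le> ereal (l u') + g u'"
    proof (cases "g u'")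
      case (real t')
      show ?thesis
      proof (cases "(u', t') \<in> K")
        case True
        then show ?thesis using e(2)[OF True] by (simp add: ut real)
      next
        case False
        then show ?thesis using u' u(3) by (simp add: K_def real)
      qed
    next
      case MInf
      then show ?thesis using minorant[OF u'] by simp
    qed simp
    finally show ?thesis .
  qed
  then show ?thesis using u(1) by blast
qed

section \<open>Block calculus\<close>

lemma blk_nth [simp]: "blk b i x $ j = (if b j = i then x $ j else 0)"
  by (simp add: blk_def)

lemma blk_in_block_space [simp]: "blk b i x \<in> block_space b i"
  by (simp add: block_space_def)

lemma blk_block_space: "z \<in> block_space b j \<Longrightarrow> blk b i z = (if i = j then z else 0)"
  by (auto simp: block_space_def vec_eq_iff)

lemma blk_linear:
  "blk b i (x + y) = blk b i x + blk b i y"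
  "blk b i (x - y) = blk b i x - blk b i y"
  "blk b i (c *\<^sub>R x) = c *\<^sub>R blk b i x"
  by (auto simp: vec_eq_iff)

lemma blk_sum: "blk b i (\<Sum>j\<in>I. g j) = (\<Sum>j\<in>I. blk b i (g j))"
  by (auto simp: vec_eq_iff)

lemma blk_sum_block_space:
  fixes b :: "'N::finite \<Rightarrow> 'n::finite"
  assumes "\<And>i. g i \<in> block_space b i"
  shows "blk b i (\<Sum>j\<in>UNIV. g j) = g i"
  by (simp add: blk_sum blk_block_space[OF assms])

lemma blk_blk_scale: "blk b i (blk_scale b u x) = u $ i *\<^sub>R blk b i x"
proof -
  have "blk b i (blk_scale b u x) = blk b i (\<Sum>j\<in>UNIV. u $ j *\<^sub>R blk b j x)"
    by (simp add: blk_scale_def)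
  also have "\<dots> = u $ i *\<^sub>R blk b i x"
    by (rule blk_sum_block_space) (simp add: block_space_def)
  finally show ?thesis .
qed

lemma blk_blk_restrict:
  fixes b :: "'N::finite \<Rightarrow> 'n::finite"
  shows "blk b i (blk_restrict b T h) = (if i \<in> T then blk b i h else 0)"
  by (auto simp: blk_restrict_def vec_eq_iff)

lemma blk_eqI: "(\<And>i. blk b i x = blk b i y) \<Longrightarrow> x = y"
  by (metis blk_nth vec_eq_iff)

lemma inner_blk:
  fixes b :: "'N::finite \<Rightarrow> 'n::finite"
  shows "x \<bullet> y = (\<Sum>i\<in>UNIV. blk b i x \<bullet> blk b i y)"
proof -
  have "(\<Sum>i\<in>UNIV. blk b i x \<bullet> blk b i y) = (\<Sum>i\<in>UNIV. \<Sum>j\<in>UNIV. if b j = i then x $ j * y $ j else 0)"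
    by (auto simp: inner_vec_def intro!: sum.cong)
  also have "\<dots> = x \<bullet> y"
    by (subst sum.swap) (simp add: inner_vec_def)
  finally show ?thesis ..
qed

lemma closed_block_space: "closed (block_space b i)"
proof -
  have "block_space b i = (\<Inter>j\<in>{j. b j \<noteq> i}. {z. z $ j = 0})"
    by (auto simp: block_space_def)
  then show ?thesis
    by (auto intro!: closed_INT closed_Collect_eq continuous_intros)
qed

lemma block_space_linear:
  "x \<in> block_space b i \<Longrightarrow> y \<in> block_space b i \<Longrightarrow> x + y \<in> block_space b i"
  "x \<in> block_space b i \<Longrightarrow> y \<in> block_space b i \<Longrightarrow> x - y \<in> block_space b i"
  "x \<in> block_space b i \<Longrightarrow> c *\<^sub>R x \<in> block_space b i"
  by (auto simp: block_space_def)

lemma bnorm_sq_blk [simp]: "bnorm_sq b B i (blk b i x) = bnorm_sq b B i x"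
  by (simp add: bnorm_sq_def blk_block_space[OF blk_in_block_space])

lemma bnorm_sq_scaleR: "bnorm_sq b B i (c *\<^sub>R x) = c\<^sup>2 * bnorm_sq b B i x"
  by (simp add: bnorm_sq_def blk_linear matrix_vector_mult_scaleR power2_eq_square)

lemma bnorm_sq_diff_commute: "bnorm_sq b B i (x - y) = bnorm_sq b B i (y - x)"
  using bnorm_sq_scaleR[of b B i "-1" "x - y"] by simp

text \<open>
  The exact strong convexity identity, on which the three-point inequality for proximal points rests.
\<close>

lemma bnorm_sq_convex_combination:
  "bnorm_sq b B i ((1 - t) *\<^sub>R x + t *\<^sub>R y)
   = (1 - t) * bnorm_sq b B i x + t * bnorm_sq b B i y - t * (1 - t) * bnorm_sq b B i (y - x)"
  by (simp add: bnorm_sq_def blk_linear inner_simps algebra_simps)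

lemma bnorm_sq_nonneg:
  assumes "pos_def_block b i (B i)"
  shows "0 \<le> bnorm_sq b B i x"
  using assms unfolding pos_def_block_def bnorm_sq_def
  by (cases "blk b i x = 0") (auto intro: less_imp_le)

lemma continuous_on_bnorm_sq: "continuous_on UNIV (bnorm_sq b B i)"
proof -
  have "continuous_on UNIV (blk b i)"
    unfolding blk_def
  proof (rule continuous_on_vec_lambda)
    show "continuous_on UNIV (\<lambda>x. if b j = i then x $ j else 0)" for j
      by (cases "b j = i") (simp_all add: continuous_on_component)
  qed
  then show ?thesis
    unfolding bnorm_sq_def
    by (intro continuous_on_inner linear_continuous_on_compose[OF _ matrix_vector_mul_linear])
qed

text \<open>
  A positive definite form is bounded below on the compact unit sphere of its block; the bound extends
  by homogeneity.
\<close>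

lemma bnorm_sq_coercive:
  assumes "pos_def_block b i (B i)"
  obtains \<mu> where "0 < \<mu>" "\<And>x. x \<in> block_space b i \<Longrightarrow> \<mu> * (norm x)\<^sup>2 \<le> bnorm_sq b B i x"
proof -
  define K where "K = block_space b i \<inter> sphere 0 1"
  have pos: "0 < bnorm_sq b B i x" if "x \<in> block_space b i" "x \<noteq> 0" for x
    using assms that by (simp add: pos_def_block_def bnorm_sq_def blk_block_space)
  have "compact K"
    unfolding K_def by (intro closed_Int_compact closed_block_space compact_sphere)
  have "\<exists>\<mu>>0. \<forall>x\<in>K. \<mu> \<le> bnorm_sq b B i x"
  proof (cases "K = {}")
    case False
    have "continuous_on K (bnorm_sq b B i)"
      by (rule continuous_on_subset[OF continuous_on_bnorm_sq]) simp
    from continuous_attains_inf[OF \<open>compact K\<close> False this]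
    obtain x where "x \<in> K" "\<forall>y\<in>K. bnorm_sq b B i x \<le> bnorm_sq b B i y"
      by blast
    moreover from \<open>x \<in> K\<close> have "0 < bnorm_sq b B i x" using pos[of x] by (cases "x = 0") (auto simp: K_def)
    ultimately show ?thesis by blast
  qed (auto intro: exI[of _ 1])
  then obtain \<mu> where \<mu>: "0 < \<mu>" "\<And>x. x \<in> K \<Longrightarrow> \<mu> \<le> bnorm_sq b B i x" by blast
  have "\<mu> * (norm x)\<^sup>2 \<le> bnorm_sq b B i x" if "x \<in> block_space b i" for x
  proof (cases "x = 0")
    case True
    then show ?thesis using assms bnorm_sq_nonneg[of b i B x] by simp
  next
    case False
    have "inverse (norm x) *\<^sub>R x \<in> K"
      using that False by (auto simp: K_def intro: block_space_linear)
    from \<mu>(2)[OF this] show ?thesis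
      using False by (simp add: bnorm_sq_scaleR field_simps power2_eq_square)
  qed
  with \<mu>(1) show ?thesis by (rule that)
qed

text \<open>
  For a blockwise quantity only the marginals of the sampling matter, whatever the dependence between
  blocks.
\<close>

lemma expectation_sampled_sum:
  fixes D :: "'n::finite set pmf"
  shows "measure_pmf.expectation D (\<lambda>T. \<Sum>i\<in>UNIV. if i \<in> T then a i else c i)
       = (\<Sum>i\<in>UNIV. sampling_prob D $ i * a i + (1 - sampling_prob D $ i) * c i)"
proof -
  have int: "integrable (measure_pmf D) g" for g :: "'n set \<Rightarrow> real"
    by (rule integrable_measure_pmf_finite) simp
  have "measure_pmf.expectation D (\<lambda>T. if i \<in> T then a i else c i)
      = sampling_prob D $ i * a i + (1 - sampling_prob D $ i) * c i" for i
  proof -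
    have "(\<lambda>T. if i \<in> T then a i else c i) = (\<lambda>T. c i + (a i - c i) * indicator {T. i \<in> T} T)"
      by (auto simp: fun_eq_iff)
    then have "measure_pmf.expectation D (\<lambda>T. if i \<in> T then a i else c i)
        = c i + (a i - c i) * sampling_prob D $ i"
      by (simp add: sampling_prob_def Bochner_Integration.integral_add int)
    then show ?thesis by (simp add: algebra_simps)
  qed
  then show ?thesis
    by (simp add: Bochner_Integration.integral_sum int)
qed

section \<open>The problem and its proximal points\<close>

lemma objective_eq_ereal:
  assumes "\<And>i. \<psi> i (blk b i x) = ereal (r i)"
  shows "objective b f \<psi> x = ereal (f x + (\<Sum>i\<in>UNIV. r i))"
  by (simp add: objective_def separable_def assms)

locale approxis_problem =
  fixes b :: "'N::finite \<Rightarrow> 'n::finite"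
    and B :: "'n \<Rightarrow> real^'N^'N"
    and f :: "real^'N \<Rightarrow> real"
    and \<psi> :: "'n \<Rightarrow> real^'N \<Rightarrow> ereal"
    and D :: "'n set pmf"
    and p v :: "real^'n"
    and x0 xs :: "real^'N"
  assumes B: "\<And>i. pos_def_block b i (B i)"
    and f_convex: "convex_on UNIV f"
    and f_diff: "\<And>x. f differentiable (at x)"
    and \<psi>_range: "\<And>i z. z \<in> block_space b i \<Longrightarrow> \<psi> i z \<noteq> -\<infinity>"
    and \<psi>_convex: "\<And>i. convex_ext_on (block_space b i) (\<psi> i)"
    and \<psi>_closed: "\<And>i. closed_ext_on (block_space b i) (\<psi> i)"
    and proper: "proper_sampling D"
    and p: "p = sampling_prob D"
    and v_pos: "\<And>i. 0 < v $ i"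
    and eso: "ESO b B f D v"
    and opt: "\<And>x. objective b f \<psi> xs \<le> objective b f \<psi> x"
    and x0: "separable b \<psi> x0 < \<infinity>"
begin

definition \<psi>_real :: "'n \<Rightarrow> real^'N \<Rightarrow> real" where "\<psi>_real i u = real_of_ereal (\<psi> i u)"

definition psi_dom :: "'n \<Rightarrow> (real^'N) set" where "psi_dom i = {u \<in> block_space b i. \<psi> i u < \<infinity>}"

definition Fstar :: real where "Fstar = f xs + (\<Sum>i\<in>UNIV. \<psi>_real i (blk b i xs))"

lemma \<psi>_eq: "u \<in> psi_dom i \<Longrightarrow> \<psi> i u = ereal (\<psi>_real i u)"
  using \<psi>_range[of u i] by (cases "\<psi> i u") (auto simp: psi_dom_def \<psi>_real_def)

lemma psi_dom_if_separable_finite: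
  assumes "separable b \<psi> x < \<infinity>"
  shows "blk b i x \<in> psi_dom i"
proof -
  have "\<psi> i (blk b i x) \<noteq> \<infinity>"
    using assms by (auto simp: separable_def sum_Pinfty)
  then show ?thesis by (cases "\<psi> i (blk b i x)") (auto simp: psi_dom_def)
qed

lemma x0_in_dom: "blk b i x0 \<in> psi_dom i"
  by (rule psi_dom_if_separable_finite[OF x0])

lemma objective_eq:
  assumes "\<And>i. blk b i x \<in> psi_dom i"
  shows "objective b f \<psi> x = ereal (f x + (\<Sum>i\<in>UNIV. \<psi>_real i (blk b i x)))"
  using assms by (intro objective_eq_ereal \<psi>_eq)

lemma xs_in_dom: "blk b i xs \<in> psi_dom i"
proof -
  have "objective b f \<psi> xs < \<infinity>"
    using opt[of x0] objective_eq[OF x0_in_dom] by auto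
  then have "separable b \<psi> xs < \<infinity>" by (auto simp: objective_def)
  then show ?thesis by (rule psi_dom_if_separable_finite)
qed

lemma objective_xs: "objective b f \<psi> xs = ereal Fstar"
  unfolding Fstar_def by (rule objective_eq) (rule xs_in_dom)

lemma psi_dom_convex:
  assumes "x \<in> psi_dom i" "w \<in> psi_dom i" "0 < t" "t < 1"
  shows "(1 - t) *\<^sub>R x + t *\<^sub>R w \<in> psi_dom i"
    and "\<psi>_real i ((1 - t) *\<^sub>R x + t *\<^sub>R w) \<le> (1 - t) * \<psi>_real i x + t * \<psi>_real i w"
proof -
  let ?u = "(1 - t) *\<^sub>R x + t *\<^sub>R w"
  have V: "x \<in> block_space b i" "w \<in> block_space b i" using assms by (auto simp: psi_dom_def)
  have le: "\<psi> i ?u \<le> ereal ((1 - t) * \<psi>_real i x + t * \<psi>_real i w)"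
    using \<psi>_convex[of i, unfolded convex_ext_on_def, rule_format, OF V assms(3,4)]
    by (simp add: \<psi>_eq assms(1,2))
  then show u: "?u \<in> psi_dom i"
    using V le_less_trans[OF le, of \<infinity>] by (simp add: psi_dom_def block_space_linear)
  show "\<psi>_real i ?u \<le> (1 - t) * \<psi>_real i x + t * \<psi>_real i w"
    using le by (simp add: \<psi>_eq[OF u])
qed

text \<open>
  Moving from \<open>xs\<close> towards \<open>w\<close> in block \<open>i\<close> alone by a fraction \<open>t\<close> does not decrease the objective; by
  convexity the change of \<open>\<psi> i\<close> is at most \<open>t\<close> times its full increment.  Dividing by \<open>t\<close> and letting
  \<open>t\<close> tend to \<open>0\<close> shows that \<open>- grad f xs\<close> is a subgradient of \<open>\<psi> i\<close> at block \<open>i\<close> of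
  \<open>xs\<close>.
\<close>

lemma \<psi>_affine_minorant:
  assumes "w \<in> block_space b i"
  shows "ereal (\<psi>_real i (blk b i xs) - grad f xs \<bullet> (w - blk b i xs)) \<le> \<psi> i w"
proof (cases "\<psi> i w < \<infinity>")
  case True
  then have w: "w \<in> psi_dom i" using assms by (simp add: psi_dom_def)
  define d where "d = w - blk b i xs"
  have dV: "d \<in> block_space b i" using assms by (simp add: d_def block_space_linear)
  have "\<psi>_real i (blk b i xs) - \<psi>_real i w \<le> grad f xs \<bullet> d"
  proof (rule tendsto_lowerbound[OF grad_directional_limit[OF f_diff]])
    show "\<forall>\<^sub>F t in at_right 0. \<psi>_real i (blk b i xs) - \<psi>_real i w \<le> (f (xs + t *\<^sub>R d) - f xs) / t"
    proof (rule eventually_at_rightI[of 0 1])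
      fix t :: real assume t: "t \<in> {0<..<1}"
      let ?x = "xs + t *\<^sub>R d" and ?u = "(1 - t) *\<^sub>R blk b i xs + t *\<^sub>R w"
      have blkx: "blk b j ?x = (if j = i then ?u else blk b j xs)" for j
        by (simp add: blk_linear blk_block_space[OF dV]) (simp add: d_def algebra_simps)
      have u: "?u \<in> psi_dom i" "\<psi>_real i ?u \<le> (1 - t) * \<psi>_real i (blk b i xs) + t * \<psi>_real i w"
        using psi_dom_convex[OF xs_in_dom w] t by auto
      have "objective b f \<psi> ?x = ereal (f ?x + (\<Sum>j\<in>UNIV. \<psi>_real j (blk b j ?x)))"
        using u(1) xs_in_dom by (intro objective_eq) (simp add: blkx)
      then have "Fstar \<le> f ?x + (\<Sum>j\<in>UNIV. \<psi>_real j (blk b j ?x))"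
        using opt[of ?x] by (simp add: objective_xs)
      also have "(\<Sum>j\<in>UNIV. \<psi>_real j (blk b j ?x))
          = \<psi>_real i ?u + (\<Sum>j\<in>UNIV - {i}. \<psi>_real j (blk b j xs))"
        by (subst sum.remove[of UNIV i]) (auto simp: blkx intro!: sum.cong)
      also have "Fstar = f xs + (\<psi>_real i (blk b i xs) + (\<Sum>j\<in>UNIV - {i}. \<psi>_real j (blk b j xs)))"
        unfolding Fstar_def by (subst sum.remove[of UNIV i]) auto
      finally have "t * (\<psi>_real i (blk b i xs) - \<psi>_real i w) \<le> f ?x - f xs"
        using u(2) by (simp add: algebra_simps)
      then show "\<psi>_real i (blk b i xs) - \<psi>_real i w \<le> (f ?x - f xs) / t"
        using t by (simp add: le_divide_eq mult.commute)
    qed simp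
  qed simp
  then show ?thesis by (simp add: \<psi>_eq[OF w] d_def)
qed (simp add: not_less)

lemma p_bounds: "0 < p $ i" "p $ i \<le> 1"
  using proper by (auto simp: p proper_sampling_def) (simp add: sampling_prob_def)

lemma vmin_bounds: "0 < vmin p" "vmin p \<le> 1" "vmin p \<le> p $ i"
proof -
  have "vmin p \<in> range (\<lambda>i. p $ i)" unfolding vmin_def by (rule Min_in) auto
  then show "0 < vmin p" "vmin p \<le> 1" using p_bounds by auto
  show "vmin p \<le> p $ i" unfolding vmin_def by (rule Min_le) auto
qed

abbreviation "\<theta> \<equiv> approxis_theta p"

lemma \<theta>_bounds: "0 < \<theta> k" "\<theta> k \<le> p $ i" "\<theta> k \<le> 1"
  using approxis_theta_pos[OF vmin_bounds(1,2), of k] approxis_theta_le[OF vmin_bounds(1,2), of k]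
    vmin_bounds(2) vmin_bounds(3)[of i] by linarith+

abbreviation "prox t y z i \<equiv> approxis_prox b B f \<psi> v p t y z i"

text \<open>
  The second part is the minimality of the proximal point \<open>u\<close> sharpened by the strong convexity of the
  subproblem: compare \<open>u\<close> with the points of the segment from \<open>u\<close> to \<open>w\<close>, divide by the step \<open>s\<close> along
  it, and let \<open>s\<close> tend to \<open>0\<close>.
\<close>

lemma prox_three_point:
  fixes i y z
  assumes t: "0 < t"
  defines "u \<equiv> prox t y z i"
    and "g \<equiv> blk b i (grad f y)"
    and "c \<equiv> t * v $ i / (2 * p $ i)"
  shows "u \<in> psi_dom i"
    and "w \<in> psi_dom i \<Longrightarrow> g \<bullet> u + c * bnorm_sq b B i (u - z) + \<psi>_real i u + c * bnorm_sq b B i (w - u)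
         \<le> g \<bullet> w + c * bnorm_sq b B i (w - z) + \<psi>_real i w"
proof -
  define l where "l u = g \<bullet> u + c * bnorm_sq b B i (u - blk b i z)" for u
  have c: "0 < c" using t v_pos[of i] p_bounds[of i] by (simp add: c_def)
  have q: "bnorm_sq b B i (u - blk b i z) = bnorm_sq b B i (u - z)" for u
    using bnorm_sq_blk[of b B i "u - blk b i z"] bnorm_sq_blk[of b B i "u - z"]
    by (simp add: blk_linear blk_block_space[OF blk_in_block_space])
  obtain \<mu> where \<mu>: "0 < \<mu>" "\<And>x. x \<in> block_space b i \<Longrightarrow> \<mu> * (norm x)\<^sup>2 \<le> bnorm_sq b B i x"
    using bnorm_sq_coercive[of b i B] B by blast
  have "\<exists>u\<in>block_space b i. \<forall>u'\<in>block_space b i. ereal (l u) + \<psi> i u \<le> ereal (l u') + \<psi> i u'"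
  proof (rule exists_minimizer_coercive[OF \<psi>_closed])
    show "continuous_on UNIV l"
      unfolding l_def
      by (intro continuous_intros continuous_on_compose2[OF continuous_on_bnorm_sq]) auto
    show "blk b i xs \<in> block_space b i" "\<psi> i (blk b i xs) < \<infinity>"
      using xs_in_dom[of i] by (auto simp: psi_dom_def)
    show "0 < c * \<mu>" using c \<mu>(1) by simp
    show "c * \<mu> * (norm (u - blk b i z))\<^sup>2 + g \<bullet> u \<le> l u" if "u \<in> block_space b i" for u
      using \<mu>(2)[of "u - blk b i z"] that c by (simp add: l_def block_space_linear mult.assoc)
    show "ereal ((\<psi>_real i (blk b i xs) + grad f xs \<bullet> blk b i xs) + (- grad f xs) \<bullet> u) \<le> \<psi> i u"
      if "u \<in> block_space b i" for u
      using \<psi>_affine_minorant[OF that] by (simp add: inner_diff_right algebra_simps)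
  qed
  then have "\<exists>u. is_arg_min (\<lambda>u. ereal (l u) + \<psi> i u) (\<lambda>u. u \<in> block_space b i) u"
    by (auto simp: is_arg_min_def not_less)
  then have "is_arg_min (\<lambda>u. ereal (l u) + \<psi> i u) (\<lambda>u. u \<in> block_space b i) u"
    unfolding u_def approxis_prox_def arg_min_def l_def g_def c_def by (rule someI_ex)
  then have uV: "u \<in> block_space b i"
    and min: "\<And>u'. u' \<in> block_space b i \<Longrightarrow> ereal (l u) + \<psi> i u \<le> ereal (l u') + \<psi> i u'"
    by (auto simp: is_arg_min_def not_less)
  have "ereal (l u) + \<psi> i u < \<infinity>"
    using le_less_trans[OF min[of "blk b i xs"], of \<infinity>] by (simp add: \<psi>_eq[OF xs_in_dom])
  then show u: "u \<in> psi_dom i" using uV by (cases "\<psi> i u") (auto simp: psi_dom_def)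
  assume w: "w \<in> psi_dom i"
  have "l u + \<psi>_real i u + c * (1 - s) * bnorm_sq b B i (w - u) \<le> l w + \<psi>_real i w" if s: "0 < s" "s < 1" for s
  proof -
    let ?m = "(1 - s) *\<^sub>R u + s *\<^sub>R w"
    note m = psi_dom_convex[OF u w s]
    have m_eq: "?m - blk b i z = (1 - s) *\<^sub>R (u - blk b i z) + s *\<^sub>R (w - blk b i z)"
      by (simp add: algebra_simps)
    have "bnorm_sq b B i (?m - blk b i z) = (1 - s) * bnorm_sq b B i (u - blk b i z)
        + s * bnorm_sq b B i (w - blk b i z) - s * (1 - s) * bnorm_sq b B i (w - u)"
      unfolding m_eq bnorm_sq_convex_combination by simp
    then have lm: "l ?m = (1 - s) * l u + s * l w - c * (s * (1 - s) * bnorm_sq b B i (w - u))"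
      by (simp add: l_def inner_add_right) (simp add: algebra_simps)
    have "l u + \<psi>_real i u \<le> l ?m + \<psi>_real i ?m"
      using min[of ?m] m(1) by (simp add: \<psi>_eq[OF u] \<psi>_eq[OF m(1)] psi_dom_def)
    also have "\<dots> \<le> l ?m + ((1 - s) * \<psi>_real i u + s * \<psi>_real i w)" using m(2) by simp
    finally have "l u + \<psi>_real i u \<le> (1 - s) * l u + s * l w - c * (s * (1 - s) * bnorm_sq b B i (w - u))
        + ((1 - s) * \<psi>_real i u + s * \<psi>_real i w)"
      unfolding lm .
    then have "s * (l u + \<psi>_real i u + c * (1 - s) * bnorm_sq b B i (w - u)) \<le> s * (l w + \<psi>_real i w)"
      by (simp add: algebra_simps)
    then show ?thesis using s by simp
  qed
  then have ev: "\<forall>\<^sub>F s in at_right 0. l u + \<psi>_real i u + c * (1 - s) * bnorm_sq b B i (w - u) \<le> l w + \<psi>_real i w"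
    by (intro eventually_at_rightI[of 0 1]) auto
  have "((\<lambda>s. l u + \<psi>_real i u + c * (1 - s) * bnorm_sq b B i (w - u))
      \<longlongrightarrow> l u + \<psi>_real i u + c * (1 - 0) * bnorm_sq b B i (w - u)) (at_right 0)"
    by (intro tendsto_intros)
  from tendsto_upperbound[OF this ev]
  show "g \<bullet> u + c * bnorm_sq b B i (u - z) + \<psi>_real i u + c * bnorm_sq b B i (w - u)
      \<le> g \<bullet> w + c * bnorm_sq b B i (w - z) + \<psi>_real i w"
    by (simp add: l_def q)
qed

section \<open>One step of the algorithm\<close>

text \<open>
  The weights \<open>v\<^sub>i / p\<^sub>i\<^sup>2\<close> are forced by the averaging over the drawn set: block \<open>i\<close> moves with probability
  \<open>p\<^sub>i\<close>, which turns them into the weights \<open>v\<^sub>i / p\<^sub>i\<close> of the proximal subproblems.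
\<close>

definition dist_weight :: "real^'n" where "dist_weight = (\<chi> i. v $ i * inverse ((p $ i)\<^sup>2))"

text \<open>
  Here \<open>s\<close> stands for an upper estimate of the values \<open>\<psi> i\<close> at the blocks of \<open>x\<close>.
\<close>

definition gap :: "real^'N \<Rightarrow> ('n \<Rightarrow> real) \<Rightarrow> real" where
  "gap x s = f x + (\<Sum>i\<in>UNIV. s i) - Fstar"

definition step_y :: "real \<Rightarrow> real^'N \<Rightarrow> real^'N \<Rightarrow> real^'N" where
  "step_y t x z = (1 - t) *\<^sub>R x + t *\<^sub>R z"

definition step_z :: "real \<Rightarrow> real^'N \<Rightarrow> real^'N \<Rightarrow> 'n set \<Rightarrow> real^'N" where
  "step_z t x z T = (\<Sum>i\<in>UNIV. if i \<in> T then prox t (step_y t x z) z i else blk b i z)"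

definition step_x :: "real \<Rightarrow> real^'N \<Rightarrow> real^'N \<Rightarrow> 'n set \<Rightarrow> real^'N" where
  "step_x t x z T = step_y t x z + t *\<^sub>R blk_scale b (\<chi> i. inverse (p $ i)) (step_z t x z T - z)"

text \<open>
  The estimate undergoes the very recursion that \<open>step_x\<close> applies to block \<open>i\<close>, with values of \<open>\<psi> i\<close> in
  place of points.
\<close>

definition step_psi_hat :: "real \<Rightarrow> real^'N \<Rightarrow> real^'N \<Rightarrow> ('n \<Rightarrow> real) \<Rightarrow> 'n set \<Rightarrow> 'n \<Rightarrow> real" where
  "step_psi_hat t x z s T i = (1 - t) * s i + t * \<psi>_real i (blk b i z)
     + t / p $ i * (\<psi>_real i (blk b i (step_z t x z T)) - \<psi>_real i (blk b i z))"

lemma p_nonzero: "p $ i \<noteq> 0"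
  using p_bounds(1)[of i] by simp

lemma blk_step_z:
  assumes "0 < t"
  shows "blk b i (step_z t x z T) = (if i \<in> T then prox t (step_y t x z) z i else blk b i z)"
  unfolding step_z_def
  by (rule blk_sum_block_space) (use prox_three_point(1)[OF assms] in \<open>auto simp: psi_dom_def\<close>)

lemma blk_step_x:
  "blk b i (step_x t x z T) = (1 - t) *\<^sub>R blk b i x + t *\<^sub>R blk b i z
     + (t / p $ i) *\<^sub>R (blk b i (step_z t x z T) - blk b i z)"
  by (simp add: step_x_def step_y_def blk_linear blk_blk_scale divide_inverse)

text \<open>
  The step of \<open>x\<close> is the restriction to the drawn blocks of a direction \<open>h\<close> with blocks
  \<open>(t / p\<^sub>i) * (u\<^sub>i - z\<^sub>i)\<close> that does not depend on the draw, so the ESO applies to \<open>h\<close>.  Its weights \<open>p\<^sub>i\<close> cancel the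
  factors \<open>1 / p\<^sub>i\<close>, leaving \<open>t\<close> times the model that the proximal points minimise.
\<close>

lemma expectation_smooth_step:
  fixes x z :: "real^'N"
  assumes t: "0 < t"
  defines "y \<equiv> step_y t x z"
  shows "measure_pmf.expectation D (\<lambda>T. f (step_x t x z T))
    \<le> f y + t * (\<Sum>i\<in>UNIV. blk b i (grad f y) \<bullet> (prox t y z i - blk b i z)
        + t * v $ i / (2 * p $ i) * bnorm_sq b B i (prox t y z i - z))"
proof -
  define u where "u i = prox t y z i" for i
  have uV: "u i \<in> block_space b i" for i
    using prox_three_point(1)[OF t, of y z i] by (simp add: psi_dom_def u_def)
  define h where "h = t *\<^sub>R blk_scale b (\<chi> i. inverse (p $ i)) ((\<Sum>i\<in>UNIV. u i) - z)"
  have blkh: "blk b i h = (t / p $ i) *\<^sub>R (u i - blk b i z)" for i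
    by (simp add: h_def blk_linear blk_blk_scale blk_sum_block_space[OF uV] divide_inverse)
  have "step_x t x z T = y + blk_restrict b T h" for T
  proof (rule blk_eqI[of b])
    fix i
    show "blk b i (step_x t x z T) = blk b i (y + blk_restrict b T h)"
      by (simp add: blk_step_x blk_step_z[OF t] blk_linear blk_blk_restrict blkh)
        (simp add: u_def y_def step_y_def blk_linear)
  qed
  then have "measure_pmf.expectation D (\<lambda>T. f (step_x t x z T))
      \<le> f y + winner b p (grad f y) h + 1 / 2 * wnorm_sq b B (\<chi> i. v $ i * p $ i) h"
    using eso[unfolded ESO_def, rule_format, of y h] by (simp flip: p)
  also have "winner b p (grad f y) h = t * (\<Sum>i\<in>UNIV. blk b i (grad f y) \<bullet> (u i - blk b i z))"
    using p_nonzero by (auto simp: winner_def blkh sum_distrib_left intro!: sum.cong)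
  also have "1 / 2 * wnorm_sq b B (\<chi> i. v $ i * p $ i) h
      = t * (\<Sum>i\<in>UNIV. t * v $ i / (2 * p $ i) * bnorm_sq b B i (u i - z))"
  proof -
    have "bnorm_sq b B i h = (t / p $ i)\<^sup>2 * bnorm_sq b B i (u i - z)" for i
    proof -
      have "bnorm_sq b B i h = bnorm_sq b B i ((t / p $ i) *\<^sub>R blk b i (u i - z))"
        using bnorm_sq_blk[of b B i h] by (simp add: blkh blk_linear blk_block_space[OF uV])
      then show ?thesis by (simp only: bnorm_sq_scaleR bnorm_sq_blk)
    qed
    then have "1 / 2 * ((\<chi> i. v $ i * p $ i) $ i * bnorm_sq b B i h)
        = t * (t * v $ i / (2 * p $ i) * bnorm_sq b B i (u i - z))" for i
      using p_bounds(1)[of i] by (simp add: power2_eq_square field_simps)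
    then show ?thesis
      unfolding wnorm_sq_def sum_distrib_left by (intro sum.cong refl)
  qed
  finally show ?thesis
    by (simp only: u_def sum.distrib distrib_left add.assoc)
qed

text \<open>
  The drift inequality.  The mean of the smooth part is bounded by, and the means of the estimates of \<open>\<psi>\<close>
  and of the distance to \<open>xs\<close> are equal to, expressions in the full proximal step \<open>u\<close> (facts \<open>smooth\<close>, \<open>reg\<close>, \<open>dist\<close>).  The three-point
  inequality, summed over the blocks, replaces \<open>u\<close> by \<open>xs\<close> and absorbs the quadratic terms
  (\<open>prox_sum\<close>).  What remains of \<open>f\<close> is its linearisation at \<open>y\<close>, which lies below \<open>f\<close> at \<open>x\<close> and at \<open>xs\<close>
  (\<open>tangent\<close>).
\<close>

lemma single_step:
  fixes x z :: "real^'N" and s :: "'n \<Rightarrow> real"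
  assumes t: "0 < t" "t \<le> 1" and z: "\<And>i. blk b i z \<in> psi_dom i"
  shows "measure_pmf.expectation D (\<lambda>T. gap (step_x t x z T) (step_psi_hat t x z s T)
            + t\<^sup>2 / 2 * wnorm_sq b B dist_weight (step_z t x z T - xs))
       \<le> (1 - t) * gap x s + t\<^sup>2 / 2 * wnorm_sq b B dist_weight (z - xs)"
proof -
  define y where "y = step_y t x z"
  define u where "u i = prox t y z i" for i
  define g where "g = grad f y"
  define c where "c i = t * v $ i / (2 * p $ i)" for i
  define q where "q i = bnorm_sq b B i" for i
  define X where "X i = blk b i xs" for i
  define Z where "Z i = blk b i z" for i
  have int: "integrable (measure_pmf D) h" for h :: "'n set \<Rightarrow> real"
    by (rule integrable_measure_pmf_finite) simp
  have blkz: "blk b i (step_z t x z T) = (if i \<in> T then u i else Z i)" for i T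
    by (simp add: blk_step_z[OF t(1)] u_def y_def Z_def)

  have smooth: "measure_pmf.expectation D (\<lambda>T. f (step_x t x z T))
      \<le> f y + t * (\<Sum>i\<in>UNIV. blk b i g \<bullet> (u i - Z i) + c i * q i (u i - z))"
    using expectation_smooth_step[OF t(1), of x z] by (simp add: u_def y_def Z_def c_def g_def q_def)

  have "(\<Sum>i\<in>UNIV. step_psi_hat t x z s T i)
      = (\<Sum>i\<in>UNIV. if i \<in> T then (1 - t) * s i + t * \<psi>_real i (Z i) + t / p $ i * (\<psi>_real i (u i) - \<psi>_real i (Z i))
                   else (1 - t) * s i + t * \<psi>_real i (Z i))" for T
    by (intro sum.cong) (auto simp: step_psi_hat_def blkz simp flip: Z_def)
  then have "measure_pmf.expectation D (\<lambda>T. \<Sum>i\<in>UNIV. step_psi_hat t x z s T i)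
      = (\<Sum>i\<in>UNIV. p $ i * ((1 - t) * s i + t * \<psi>_real i (Z i) + t / p $ i * (\<psi>_real i (u i) - \<psi>_real i (Z i)))
            + (1 - p $ i) * ((1 - t) * s i + t * \<psi>_real i (Z i)))"
    by (simp add: expectation_sampled_sum p)
  also have "\<dots> = (\<Sum>i\<in>UNIV. (1 - t) * s i + t * \<psi>_real i (u i))"
    using p_nonzero by (intro sum.cong refl) (simp add: field_simps)
  finally have reg: "measure_pmf.expectation D (\<lambda>T. \<Sum>i\<in>UNIV. step_psi_hat t x z s T i)
      = (1 - t) * (\<Sum>i\<in>UNIV. s i) + t * (\<Sum>i\<in>UNIV. \<psi>_real i (u i))"
    by (simp add: sum.distrib sum_distrib_left)

  have "wnorm_sq b B dist_weight (step_z t x z T - xs)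
      = (\<Sum>i\<in>UNIV. if i \<in> T then dist_weight $ i * q i (u i - xs) else dist_weight $ i * q i (z - xs))" for T
  proof -
    have "q i (step_z t x z T - xs) = (if i \<in> T then q i (u i - xs) else q i (z - xs))" for i
    proof -
      have "q i (step_z t x z T - xs) = q i (blk b i (step_z t x z T) - xs)"
        using bnorm_sq_blk[of b B i "step_z t x z T - xs"]
          bnorm_sq_blk[of b B i "blk b i (step_z t x z T) - xs"]
        by (simp add: q_def blk_linear blk_block_space[OF blk_in_block_space])
      moreover have "q i (Z i - xs) = q i (z - xs)"
        using bnorm_sq_blk[of b B i "z - xs"] bnorm_sq_blk[of b B i "Z i - xs"]
        by (simp add: q_def Z_def blk_linear blk_block_space[OF blk_in_block_space])
      ultimately show ?thesis by (simp add: blkz)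
    qed
    then show ?thesis by (auto simp: wnorm_sq_def q_def intro!: sum.cong)
  qed
  then have "measure_pmf.expectation D (\<lambda>T. wnorm_sq b B dist_weight (step_z t x z T - xs))
      = (\<Sum>i\<in>UNIV. p $ i * (dist_weight $ i * q i (u i - xs)) + (1 - p $ i) * (dist_weight $ i * q i (z - xs)))"
    by (simp add: expectation_sampled_sum p)
  also have "t\<^sup>2 / 2 * \<dots> = t\<^sup>2 / 2 * wnorm_sq b B dist_weight (z - xs)
      + t * (\<Sum>i\<in>UNIV. c i * q i (u i - xs) - c i * q i (z - xs))"
  proof -
    have "t\<^sup>2 / 2 * (p $ i * (dist_weight $ i * q i (u i - xs)) + (1 - p $ i) * (dist_weight $ i * q i (z - xs)))
        = t\<^sup>2 / 2 * (dist_weight $ i * q i (z - xs)) + t * (c i * q i (u i - xs) - c i * q i (z - xs))" for i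
      using p_bounds(1)[of i] by (simp add: dist_weight_def c_def power2_eq_square field_simps)
    then show ?thesis
      unfolding wnorm_sq_def sum_distrib_left sum.distrib[symmetric] q_def[symmetric]
      by (intro sum.cong refl)
  qed
  finally have dist: "t\<^sup>2 / 2 * measure_pmf.expectation D (\<lambda>T. wnorm_sq b B dist_weight (step_z t x z T - xs))
      = t\<^sup>2 / 2 * wnorm_sq b B dist_weight (z - xs)
      + t * (\<Sum>i\<in>UNIV. c i * q i (u i - xs) - c i * q i (z - xs))" .

  have prox_le: "blk b i g \<bullet> (u i - Z i) + c i * q i (u i - z) + \<psi>_real i (u i) + (c i * q i (u i - xs) - c i * q i (z - xs))
      \<le> blk b i g \<bullet> (X i - Z i) + \<psi>_real i (X i)" for i
  proof -
    have qX: "q i (X i - w) = q i (w - xs)" for w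
      using bnorm_sq_blk[of b B i "X i - w"] bnorm_sq_blk[of b B i "xs - w"] bnorm_sq_diff_commute[of b B i xs w]
      by (simp add: q_def X_def blk_linear blk_block_space[OF blk_in_block_space])
    show ?thesis
      using prox_three_point(2)[OF t(1) xs_in_dom, of i y z]
      by (simp add: qX flip: g_def u_def c_def q_def X_def) (simp add: inner_diff_right)
  qed
  have "(\<Sum>i\<in>UNIV. blk b i g \<bullet> (u i - Z i) + c i * q i (u i - z)) + (\<Sum>i\<in>UNIV. \<psi>_real i (u i))
        + (\<Sum>i\<in>UNIV. c i * q i (u i - xs) - c i * q i (z - xs))
      \<le> (\<Sum>i\<in>UNIV. blk b i g \<bullet> (X i - Z i) + \<psi>_real i (X i))"
    unfolding sum.distrib[symmetric] by (intro sum_mono prox_le)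
  also have "\<dots> = g \<bullet> (xs - z) + (Fstar - f xs)"
    by (simp add: sum.distrib Fstar_def X_def Z_def inner_blk[of g "xs - z" b] blk_linear)
  finally have prox_sum: "t * ((\<Sum>i\<in>UNIV. blk b i g \<bullet> (u i - Z i) + c i * q i (u i - z)) + (\<Sum>i\<in>UNIV. \<psi>_real i (u i))
        + (\<Sum>i\<in>UNIV. c i * q i (u i - xs) - c i * q i (z - xs)))
      \<le> t * (g \<bullet> (xs - z) + (Fstar - f xs))"
    using t(1) by simp

  have tangent: "f y + t * (g \<bullet> (xs - z)) \<le> (1 - t) * f x + t * f xs"
  proof -
    \<comment> \<open>The choice of \<open>y\<close> makes \<open>(1 - t) * (x - y) + t * (xs - y)\<close> equal to \<open>t * (xs - z)\<close>.\<close>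
    have "(1 - t) * (f y + g \<bullet> (x - y)) + t * (f y + g \<bullet> (xs - y)) \<le> (1 - t) * f x + t * f xs"
      using t by (intro add_mono mult_left_mono) (auto simp: g_def intro: convex_on_above_tangent_plane f_convex f_diff)
    moreover have "(1 - t) * (g \<bullet> (x - y)) + t * (g \<bullet> (xs - y)) = t * (g \<bullet> (xs - z))"
      by (simp add: y_def step_y_def inner_simps) (simp add: algebra_simps)
    ultimately show ?thesis by (simp add: algebra_simps)
  qed

  have "measure_pmf.expectation D (\<lambda>T. gap (step_x t x z T) (step_psi_hat t x z s T)
            + t\<^sup>2 / 2 * wnorm_sq b B dist_weight (step_z t x z T - xs))
      = measure_pmf.expectation D (\<lambda>T. f (step_x t x z T))
        + measure_pmf.expectation D (\<lambda>T. \<Sum>i\<in>UNIV. step_psi_hat t x z s T i) - Fstar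
        + t\<^sup>2 / 2 * measure_pmf.expectation D (\<lambda>T. wnorm_sq b B dist_weight (step_z t x z T - xs))"
    unfolding gap_def
    by (simp add: Bochner_Integration.integral_add Bochner_Integration.integral_diff int
        del: Bochner_Integration.integral_sum)
  also have "\<dots> \<le> (1 - t) * gap x s + t\<^sup>2 / 2 * wnorm_sq b B dist_weight (z - xs)"
    using smooth prox_sum tangent unfolding reg dist
    by (simp add: gap_def algebra_simps)
  finally show ?thesis .
qed

section \<open>The iterates along a fixed sequence of draws\<close>

definition xk :: "(nat \<Rightarrow> 'n set) \<Rightarrow> nat \<Rightarrow> real^'N" where
  "xk T k = fst (approxis b B f \<psi> v p x0 T k)"

definition zk :: "(nat \<Rightarrow> 'n set) \<Rightarrow> nat \<Rightarrow> real^'N" where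
  "zk T k = snd (approxis b B f \<psi> v p x0 T k)"

lemma xk_zk_simps:
  "xk T 0 = x0" "zk T 0 = x0"
  "zk T (Suc k) = step_z (\<theta> k) (xk T k) (zk T k) (T k)"
  "xk T (Suc k) = step_x (\<theta> k) (xk T k) (zk T k) (T k)"
  by (simp_all add: xk_def zk_def step_x_def step_z_def step_y_def Let_def case_prod_beta cong: if_cong)

text \<open>
  The surrogate for \<open>\<psi> i\<close> at block \<open>i\<close> of \<open>x\<^sub>k\<close>, averaged over the values at the former \<open>z\<close>.
\<close>

primrec psi_hat :: "(nat \<Rightarrow> 'n set) \<Rightarrow> nat \<Rightarrow> 'n \<Rightarrow> real" where
  "psi_hat T 0 = (\<lambda>i. \<psi>_real i (blk b i x0))"
| "psi_hat T (Suc k) = step_psi_hat (\<theta> k) (xk T k) (zk T k) (psi_hat T k) (T k)"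

lemma iterates_depend_on_prefix:
  assumes "\<And>j. j < k \<Longrightarrow> T j = T' j"
  shows "xk T k = xk T' k \<and> zk T k = zk T' k \<and> psi_hat T k = psi_hat T' k"
  using assms
proof (induction k)
  case (Suc k)
  then have "xk T k = xk T' k \<and> zk T k = zk T' k \<and> psi_hat T k = psi_hat T' k" by simp
  then show ?case using Suc.prems by (simp add: xk_zk_simps)
qed (simp add: xk_zk_simps)

lemma zk_in_dom: "blk b i (zk T k) \<in> psi_dom i"
proof (induction k)
  case 0
  then show ?case by (simp add: xk_zk_simps x0_in_dom)
next
  case (Suc k)
  then show ?case
    using prox_three_point(1)[OF \<theta>_bounds(1)[of k]]
    by (simp add: xk_zk_simps blk_step_z[OF \<theta>_bounds(1)])
qed

text \<open>
  The pair of a block of \<open>x\<^sub>k\<close> and its surrogate value obeys the recursion of \<open>convex_accelerated_average\<close>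
  driven by points on the graph of \<open>\<psi> i\<close>; hence it lies in the epigraph of \<open>\<psi> i\<close>, which is convex.
\<close>

lemma psi_le_psi_hat:
  "blk b i (xk T k) \<in> psi_dom i \<and> \<psi>_real i (blk b i (xk T k)) \<le> psi_hat T k i"
proof -
  define C where "C = {(u, r). u \<in> psi_dom i \<and> \<psi>_real i u \<le> r}"
  have "convex C"
    unfolding convex_alt
  proof (intro ballI allI impI)
    fix e e' t assume e: "e \<in> C" "e' \<in> C" and t: "0 \<le> t \<and> t \<le> (1::real)"
    obtain u r u' r' where ee: "e = (u, r)" "e' = (u', r')" by (cases e, cases e') auto
    have u: "u \<in> psi_dom i" "u' \<in> psi_dom i" "\<psi>_real i u \<le> r" "\<psi>_real i u' \<le> r'"
      using e by (auto simp: C_def ee)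
    show "(1 - t) *\<^sub>R e + t *\<^sub>R e' \<in> C"
    proof (cases "t = 0 \<or> t = 1")
      case True
      then show ?thesis using e by auto
    next
      case False
      then have t': "0 < t" "t < 1" using t by auto
      have "(1 - t) * \<psi>_real i u + t * \<psi>_real i u' \<le> (1 - t) * r + t * r'"
        using u t by (intro add_mono mult_left_mono) auto
      with psi_dom_convex[OF u(1,2) t'] show ?thesis by (simp add: C_def ee)
    qed
  qed
  then have "(blk b i (xk T k), psi_hat T k i) \<in> C"
  proof (rule convex_accelerated_average[where \<theta> = \<theta> and p = "p $ i"
        and X = "\<lambda>k. (blk b i (xk T k), psi_hat T k i)"
        and Z = "\<lambda>k. (blk b i (zk T k), \<psi>_real i (blk b i (zk T k)))"])
    show "(blk b i (xk T (Suc k)), psi_hat T (Suc k) i)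
        = (1 - \<theta> k) *\<^sub>R (blk b i (xk T k), psi_hat T k i)
          + \<theta> k *\<^sub>R (blk b i (zk T k), \<psi>_real i (blk b i (zk T k)))
          + (\<theta> k / p $ i) *\<^sub>R ((blk b i (zk T (Suc k)), \<psi>_real i (blk b i (zk T (Suc k))))
              - (blk b i (zk T k), \<psi>_real i (blk b i (zk T k))))" for k
      by (simp add: xk_zk_simps blk_step_x step_psi_hat_def del: approxis_theta.simps)
    show "\<theta> (Suc k) \<le> \<theta> k" for k
      by (rule approxis_theta_decreasing[OF vmin_bounds(1,2)])
  qed (use zk_in_dom \<theta>_bounds p_bounds in \<open>auto simp: C_def xk_zk_simps simp del: approxis_theta.simps\<close>)
  then show ?thesis by (simp add: C_def)
qed

abbreviation "gap_k T k \<equiv> gap (xk T k) (psi_hat T k)"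

lemma objective_gap_le:
  shows "objective b f \<psi> (xk T k) - objective b f \<psi> xs \<le> ereal (gap_k T k)"
    and gap_nonneg: "0 \<le> gap_k T k"
proof -
  have obj: "objective b f \<psi> (xk T k) = ereal (f (xk T k) + (\<Sum>i\<in>UNIV. \<psi>_real i (blk b i (xk T k))))"
    by (rule objective_eq) (use psi_le_psi_hat in blast)
  have le: "(\<Sum>i\<in>UNIV. \<psi>_real i (blk b i (xk T k))) \<le> (\<Sum>i\<in>UNIV. psi_hat T k i)"
    by (intro sum_mono) (use psi_le_psi_hat in blast)
  show "objective b f \<psi> (xk T k) - objective b f \<psi> xs \<le> ereal (gap_k T k)"
    using le by (simp add: obj objective_xs gap_def)
  have "Fstar \<le> f (xk T k) + (\<Sum>i\<in>UNIV. \<psi>_real i (blk b i (xk T k)))"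
    using opt[of "xk T k"] by (simp add: obj objective_xs)
  with le show "0 \<le> gap_k T k" by (simp add: gap_def)
qed

definition dist_k :: "(nat \<Rightarrow> 'n set) \<Rightarrow> nat \<Rightarrow> real" where
  "dist_k T k = wnorm_sq b B dist_weight (zk T k - xs)"

lemma dist_k_nonneg: "0 \<le> dist_k T k"
  unfolding dist_k_def wnorm_sq_def
  using v_pos B by (intro sum_nonneg mult_nonneg_nonneg bnorm_sq_nonneg)
    (auto simp: dist_weight_def less_imp_le)

section \<open>Decay of the expected potential\<close>

text \<open>
  The right-hand side of \<open>single_step\<close>, as a function of the history.
\<close>

definition potential :: "(nat \<Rightarrow> 'n set) \<Rightarrow> nat \<Rightarrow> real" where
  "potential T k = (1 - \<theta> k) * gap_k T k + (\<theta> k)\<^sup>2 / 2 * dist_k T k"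

text \<open>
  The recursion for the step sizes is designed for this identity: it scales the left-hand side of one
  drift inequality to the right-hand side of the next.
\<close>

lemma potential_Suc:
  "potential T (Suc k) = (\<theta> (Suc k) / \<theta> k)\<^sup>2 * (gap_k T (Suc k) + (\<theta> k)\<^sup>2 / 2 * dist_k T (Suc k))"
proof -
  define r where "r = (\<theta> (Suc k) / \<theta> k)\<^sup>2"
  have "1 - \<theta> (Suc k) = r" "(\<theta> (Suc k))\<^sup>2 = r * (\<theta> k)\<^sup>2"
    using approxis_theta_rec[OF vmin_bounds(1,2), of k] \<theta>_bounds(1)[of k]
    by (simp_all add: r_def power_divide del: approxis_theta.simps)
  then show ?thesis
    by (simp add: potential_def distrib_left flip: r_def del: approxis_theta.simps psi_hat.simps)
qed

abbreviation "prefix_law k \<equiv> measure_pmf (Pi_pmf {..<k} {} (\<lambda>_. D))"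

lemma nn_integral_prefix_law_Suc:
  "(\<integral>\<^sup>+\<tau>. H \<tau> \<partial>prefix_law (Suc k)) = (\<integral>\<^sup>+\<tau>. (\<integral>\<^sup>+T. H (\<tau>(k := T)) \<partial>measure_pmf D) \<partial>prefix_law k)"
proof -
  have "Pi_pmf {..<Suc k} {} (\<lambda>_. D)
      = bind_pmf D (\<lambda>T. bind_pmf (Pi_pmf {..<k} {} (\<lambda>_. D)) (\<lambda>\<tau>. return_pmf (\<tau>(k := T))))"
    unfolding lessThan_Suc by (rule Pi_pmf_insert') auto
  also have "\<dots> = bind_pmf (Pi_pmf {..<k} {} (\<lambda>_. D)) (\<lambda>\<tau>. bind_pmf D (\<lambda>T. return_pmf (\<tau>(k := T))))"
    by (rule bind_commute_pmf)
  finally show ?thesis by simp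
qed

text \<open>
  Conditioning on the first \<open>k\<close> draws: the state at index \<open>k\<close> is fixed by them, and \<open>single_step\<close> treats
  the mean over the remaining draw.
\<close>

lemma expected_step:
  "(\<integral>\<^sup>+\<tau>. ennreal (gap_k \<tau> (Suc k) + (\<theta> k)\<^sup>2 / 2 * dist_k \<tau> (Suc k)) \<partial>prefix_law (Suc k))
   \<le> (\<integral>\<^sup>+\<tau>. ennreal (potential \<tau> k) \<partial>prefix_law k)"
  unfolding nn_integral_prefix_law_Suc
proof (rule nn_integral_mono)
  fix \<tau>
  have prefix: "xk (\<tau>(k := T)) k = xk \<tau> k" "zk (\<tau>(k := T)) k = zk \<tau> k"
    "psi_hat (\<tau>(k := T)) k = psi_hat \<tau> k" for T
    using iterates_depend_on_prefix[of k "\<tau>(k := T)" \<tau>] by auto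
  let ?W = "\<lambda>T. gap_k (\<tau>(k := T)) (Suc k) + (\<theta> k)\<^sup>2 / 2 * dist_k (\<tau>(k := T)) (Suc k)"
  have "(\<integral>\<^sup>+T. ennreal (?W T) \<partial>measure_pmf D) = ennreal (measure_pmf.expectation D ?W)"
    using gap_nonneg dist_k_nonneg
    by (intro nn_integral_eq_integral integrable_measure_pmf_finite AE_I2) (simp_all del: psi_hat.simps)
  also have "\<dots> \<le> ennreal (potential \<tau> k)"
    using single_step[OF \<theta>_bounds(1,3), of "zk \<tau> k" k "xk \<tau> k" "psi_hat \<tau> k"] zk_in_dom
    by (intro ennreal_leI) (simp add: xk_zk_simps prefix dist_k_def potential_def)
  finally show "(\<integral>\<^sup>+T. ennreal (?W T) \<partial>measure_pmf D) \<le> ennreal (potential \<tau> k)" .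
qed

lemma expected_potential:
  "(\<integral>\<^sup>+\<tau>. ennreal (potential \<tau> k) \<partial>prefix_law k) \<le> ennreal ((\<theta> k / vmin p)\<^sup>2 * potential (\<lambda>_. {}) 0)"
proof (induction k)
  case 0
  have "potential \<tau> 0 = potential (\<lambda>_. {}) 0" for \<tau>
    by (simp add: potential_def dist_k_def xk_zk_simps)
  then show ?case using vmin_bounds(1) by simp
next
  case (Suc k)
  let ?c = "(\<theta> (Suc k) / \<theta> k)\<^sup>2"
  have "(\<integral>\<^sup>+\<tau>. ennreal (potential \<tau> (Suc k)) \<partial>prefix_law (Suc k))
      = ennreal ?c * (\<integral>\<^sup>+\<tau>. ennreal (gap_k \<tau> (Suc k) + (\<theta> k)\<^sup>2 / 2 * dist_k \<tau> (Suc k)) \<partial>prefix_law (Suc k))"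
    unfolding potential_Suc
    by (subst nn_integral_cmult[symmetric])
      (auto simp: gap_nonneg dist_k_nonneg ennreal_mult simp del: approxis_theta.simps psi_hat.simps)
  also have "\<dots> \<le> ennreal ?c * ennreal ((\<theta> k / vmin p)\<^sup>2 * potential (\<lambda>_. {}) 0)"
    by (intro mult_left_mono order_trans[OF expected_step Suc]) simp
  also have "\<dots> = ennreal (?c * ((\<theta> k / vmin p)\<^sup>2 * potential (\<lambda>_. {}) 0))"
    by (simp only: ennreal_mult'[OF zero_le_power2])
  also have "?c * ((\<theta> k / vmin p)\<^sup>2 * potential (\<lambda>_. {}) 0)
      = (\<theta> (Suc k) / vmin p)\<^sup>2 * potential (\<lambda>_. {}) 0"
    using \<theta>_bounds(1)[of k] by (simp add: power_divide del: approxis_theta.simps)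
  finally show ?case .
qed

text \<open>
  At index \<open>0\<close> the surrogate is exact and \<open>\<theta> 0 = vmin p\<close>; squaring is monotone on positive numbers, so
  the minimum of \<open>(p $ i)\<^sup>2 / 2\<close> is attained where \<open>p $ i\<close> is smallest.
\<close>

lemma potential_0: "potential T 0 = approxis_const b B f \<psi> v p x0 xs"
proof -
  have "vmin p \<in> range (\<lambda>i. p $ i)" unfolding vmin_def by (rule Min_in) auto
  then obtain m where m: "vmin p = p $ m" by auto
  have "Min (range (\<lambda>i. (p $ i)\<^sup>2 / 2)) = (vmin p)\<^sup>2 / 2"
  proof (rule Min_eqI)
    show "(vmin p)\<^sup>2 / 2 \<le> y" if "y \<in> range (\<lambda>i. (p $ i)\<^sup>2 / 2)" for y
      using that power_mono[OF vmin_bounds(3) less_imp_le[OF vmin_bounds(1)]] by auto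
    show "(vmin p)\<^sup>2 / 2 \<in> range (\<lambda>i. (p $ i)\<^sup>2 / 2)" unfolding m by blast
  qed simp
  then show ?thesis
    by (simp add: potential_def approxis_const_def dist_k_def dist_weight_def gap_def xk_zk_simps
        objective_eq[OF x0_in_dom] objective_xs)
qed

text \<open>
  The bound for \<open>x\<close> at index \<open>Suc k\<close> carries the step size of index \<open>k\<close>, because the last drift inequality is
  used before its rescaling; dropping the distance term from it leaves the gap itself.
\<close>

lemma expected_gap_le:
  assumes "prob_space M"
    and distr: "\<And>k. distr M (count_space UNIV) (S k) = measure_pmf D"
    and indep: "prob_space.indep_vars M (\<lambda>_. count_space UNIV) S UNIV"
  shows "expected_gap M (objective b f \<psi>) xs (\<lambda>\<omega>. approxis_x b B f \<psi> v p x0 (\<lambda>j. S j \<omega>) (Suc k))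
    \<le> ennreal ((\<theta> k / vmin p)\<^sup>2 * approxis_const b B f \<psi> v p x0 xs)"
proof -
  interpret prob_space M by fact
  have "xk (\<lambda>j. S j \<omega>) (Suc k) = xk (\<lambda>j. if j < Suc k then S j \<omega> else {}) (Suc k)" for \<omega>
    using iterates_depend_on_prefix[of "Suc k" "\<lambda>j. S j \<omega>" "\<lambda>j. if j < Suc k then S j \<omega> else {}"]
    by simp
  then have "expected_gap M (objective b f \<psi>) xs (\<lambda>\<omega>. approxis_x b B f \<psi> v p x0 (\<lambda>j. S j \<omega>) (Suc k))
      = (\<integral>\<^sup>+\<omega>. e2ennreal (objective b f \<psi> (xk (\<lambda>j. if j < Suc k then S j \<omega> else {}) (Suc k))
            - objective b f \<psi> xs) \<partial>M)"
    unfolding expected_gap_def approxis_x_def xk_def by presburger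
  also have "\<dots> = (\<integral>\<^sup>+\<tau>. e2ennreal (objective b f \<psi> (xk \<tau> (Suc k)) - objective b f \<psi> xs) \<partial>prefix_law (Suc k))"
    by (rule nn_integral_iid_prefix[OF indep distr])
  also have "\<dots> \<le> (\<integral>\<^sup>+\<tau>. ennreal (gap_k \<tau> (Suc k) + (\<theta> k)\<^sup>2 / 2 * dist_k \<tau> (Suc k)) \<partial>prefix_law (Suc k))"
  proof (rule nn_integral_mono)
    fix \<tau>
    have "e2ennreal (objective b f \<psi> (xk \<tau> (Suc k)) - objective b f \<psi> xs) \<le> e2ennreal (ereal (gap_k \<tau> (Suc k)))"
      by (intro e2ennreal_mono objective_gap_le)
    also have "\<dots> \<le> ennreal (gap_k \<tau> (Suc k) + (\<theta> k)\<^sup>2 / 2 * dist_k \<tau> (Suc k))"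
      using dist_k_nonneg[of \<tau> "Suc k"] by (simp add: ennreal_leI del: psi_hat.simps)
    finally show "e2ennreal (objective b f \<psi> (xk \<tau> (Suc k)) - objective b f \<psi> xs)
        \<le> ennreal (gap_k \<tau> (Suc k) + (\<theta> k)\<^sup>2 / 2 * dist_k \<tau> (Suc k))" .
  qed
  also have "\<dots> \<le> ennreal ((\<theta> k / vmin p)\<^sup>2 * potential (\<lambda>_. {}) 0)"
    by (rule order_trans[OF expected_step expected_potential])
  finally show ?thesis by (simp only: potential_0)
qed

lemma approxis_const_nonneg: "0 \<le> approxis_const b B f \<psi> v p x0 xs"
  using gap_nonneg[of "\<lambda>_. {}" 0] dist_k_nonneg[of "\<lambda>_. {}" 0] vmin_bounds(2)
  unfolding potential_0[of "\<lambda>_. {}", symmetric] potential_def by simp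

end

section \<open>The convergence rate\<close>

theorem corollary8:
  fixes b :: "'N::finite \<Rightarrow> 'n::finite"
    and B :: "'n \<Rightarrow> real^'N^'N"
    and f :: "real^'N \<Rightarrow> real"
    and \<psi> :: "'n \<Rightarrow> real^'N \<Rightarrow> ereal"
    and D :: "'n set pmf"
    and p v :: "real^'n"
    and x0 xs :: "real^'N"
    and M :: "'w measure"
    and S :: "nat \<Rightarrow> 'w \<Rightarrow> 'n set"
  assumes blocks: "surj b"
    and B: "\<And>i. pos_def_block b i (B i)"
    and f_convex: "convex_on UNIV f"
    and f_diff: "\<And>x. f differentiable (at x)"
    and \<psi>_range: "\<And>i z. z \<in> block_space b i \<Longrightarrow> \<psi> i z \<noteq> -\<infinity>"
    and \<psi>_convex: "\<And>i. convex_ext_on (block_space b i) (\<psi> i)"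
    and \<psi>_closed: "\<And>i. closed_ext_on (block_space b i) (\<psi> i)"
    and proper: "proper_sampling D"
    and p: "p = sampling_prob D"
    and v_pos: "\<And>i. 0 < v $ i"
    and eso: "ESO b B f D v"
    and opt: "\<And>x. objective b f \<psi> xs \<le> objective b f \<psi> x"
    and x0: "separable b \<psi> x0 < \<infinity>"
    and prob: "prob_space M"
    and S_distr: "\<And>k. distr M (count_space UNIV) (S k) = measure_pmf D"
    and S_indep: "prob_space.indep_vars M (\<lambda>_. count_space UNIV) S UNIV"
  shows "(\<forall>k\<ge>1. expected_gap M (objective b f \<psi>) xs
                    (\<lambda>\<omega>. approxis_x b B f \<psi> v p x0 (\<lambda>j. S j \<omega>) k)
                 \<le> ennreal (4 * approxis_const b B f \<psi> v p x0 xs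
                             / ((real k - 1) * vmin p + 2)\<^sup>2))
       \<and> (\<forall>\<epsilon>>0. \<forall>k\<ge>1.
            real k \<ge> 2 * sqrt (approxis_const b B f \<psi> v p x0 xs) / (sqrt \<epsilon> * vmin p)
                     - 2 / vmin p + 1
            \<longrightarrow> expected_gap M (objective b f \<psi>) xs
                  (\<lambda>\<omega>. approxis_x b B f \<psi> v p x0 (\<lambda>j. S j \<omega>) k) \<le> ennreal \<epsilon>)"
proof -
  interpret approxis_problem b B f \<psi> D p v x0 xs
    by unfold_locales (fact B f_convex f_diff \<psi>_range \<psi>_convex \<psi>_closed proper p v_pos eso opt x0)+
  define C where "C = approxis_const b B f \<psi> v p x0 xs"
  define gap_at where "gap_at k = expected_gap M (objective b f \<psi>) xs
      (\<lambda>\<omega>. approxis_x b B f \<psi> v p x0 (\<lambda>j. S j \<omega>) k)" for k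
  have C: "0 \<le> C" by (simp add: C_def approxis_const_nonneg)
  have rate: "gap_at k \<le> ennreal (4 * C / ((real k - 1) * vmin p + 2)\<^sup>2)" if k: "1 \<le> k" for k
  proof -
    obtain l where l: "k = Suc l" using k by (cases k) auto
    have "(\<theta> l / vmin p)\<^sup>2 \<le> (2 / (real l * vmin p + 2))\<^sup>2"
      using approxis_theta_decay[OF vmin_bounds(1,2), of l] \<theta>_bounds(1)[of l] vmin_bounds(1)
      by (intro power_mono) auto
    then have "(\<theta> l / vmin p)\<^sup>2 * C \<le> 4 * C / ((real k - 1) * vmin p + 2)\<^sup>2"
      using mult_right_mono[OF _ C] by (fastforce simp: l power_divide)
    then show ?thesis
      using expected_gap_le[OF prob S_distr S_indep, of l] order_trans[OF _ ennreal_leI]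
      by (simp add: gap_at_def C_def l)
  qed
  have "gap_at k \<le> ennreal \<epsilon>"
    if \<epsilon>: "0 < \<epsilon>" and k: "1 \<le> k" and large: "2 * sqrt C / (sqrt \<epsilon> * vmin p) - 2 / vmin p + 1 \<le> real k" for \<epsilon> k
  proof -
    define d where "d = (real k - 1) * vmin p + 2"
    have d: "0 < d" using k vmin_bounds(1) by (simp add: d_def add_nonneg_pos)
    \<comment> \<open>The threshold on \<open>k\<close>, multiplied by \<open>vmin p\<close>, says that \<open>2 * sqrt C / sqrt \<epsilon> \<le> d\<close>.\<close>
    have "2 * sqrt C / sqrt \<epsilon> = (2 * sqrt C / (sqrt \<epsilon> * vmin p)) * vmin p"
      using vmin_bounds(1) by simp
    also have "\<dots> \<le> (real k - 1 + 2 / vmin p) * vmin p"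
      using large vmin_bounds(1) by (intro mult_right_mono) auto
    also have "\<dots> = d" using vmin_bounds(1) by (simp add: d_def field_simps)
    finally have "2 * sqrt C \<le> d * sqrt \<epsilon>" using \<epsilon> by (simp add: divide_le_eq)
    then have "(2 * sqrt C)\<^sup>2 \<le> (d * sqrt \<epsilon>)\<^sup>2" using C by (intro power_mono) auto
    then have "4 * C / d\<^sup>2 \<le> \<epsilon>"
      using C \<epsilon> d by (simp add: power_mult_distrib divide_le_eq mult.commute)
    then show ?thesis
      using rate[OF k] unfolding d_def by (meson ennreal_leI order_trans)
  qed
  with rate show ?thesis by (simp add: C_def gap_at_def)
qed

end
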